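(* Let $\ell\in\mathbb{N}$, let $(X,\mathcal{B},\mu)$ be a probability space, let $T_1,\ldots,T_\ell:X\to X$ be invertible measure preserving transformations (no commutativity is assumed), and let $f_1,\ldots,f_\ell\in L^\infty(\mu)$. Let $g_1,\ldots,g_\ell\in\mathcal{F}$ satisfy $g_\ell\prec\cdots\prec g_1$ and be such that $g'_{i+1}(x)/g'_i(x)$ is eventually monotone for all $1\le i\le\ell-1$. Then $$\lim_{N\to\infty}\left\|\frac{1}{N}\sum_{n=1}^N T_1^{[g_1(n)]}f_1\cdots T_\ell^{[g_\ell(n)]}f_\ell-\prod_{i=1}^\ell \mathbb{E}(f_i\mid\mathcal{I}(T_i))\right\|_{L^2(\mu)}=0.$$
   Context: $Tf:=f\circ T$. $[x]$ is the largest integer $\le x$. $\mathcal{I}(T)$ is the $\sigma$-algebra of $T$-invariant sets and $\mathbb{E}(\cdot\mid\mathcal{I}(T))$ the conditional expectation. $\mathbb{R}^+$ denotes some half-line $[x_0,\infty)$, $x_0\ge0$ (allowed to depend on the function); all statements about functions concern sufficiently large $x$ (values of $g(n)$ for finitely many $n$ are irrelevant). $g_2\prec g_1$ means $|g_1(x)|/|g_2(x)|\to\infty$ as $x\to\infty$. A real-valued function $g$, continuously differentiable on some $[x_0,\infty)$, is a Fejér function if $g'(x)$ tends monotonically to $0$ as $x\to\infty$ and $\lim_{x\to\infty}x|g'(x)|=\infty$. $\mathcal{F}:=\{g\in C^\infty(\mathbb{R}^+):\ g\text{ is Fejér and there exists }\alpha\in(0,1]\text{ with }\lim_{x\to\infty}\frac{xg''(x)}{g'(x)}=\alpha-1\}$.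 *)

theory Defs
  imports "HOL-Probability.Probability"
begin

definition measure_preserving_map :: "'a measure \<Rightarrow> ('a \<Rightarrow> 'a) \<Rightarrow> bool" where
  "measure_preserving_map M T \<longleftrightarrow>
     T \<in> M \<rightarrow>\<^sub>M M \<and> (\<forall>A\<in>sets M. emeasure M (T -` A \<inter> space M) = emeasure M A)"

definition invertible_mpt :: "'a measure \<Rightarrow> ('a \<Rightarrow> 'a) \<Rightarrow> bool" where
  "invertible_mpt M T \<longleftrightarrow>
     measure_preserving_map M T \<and> bij_betw T (space M) (space M) \<and>
     the_inv_into (space M) T \<in> M \<rightarrow>\<^sub>M M"

text \<open>The Fejer functions below may tend to minus infinity, so negative powers of the
  transformation do occur.\<close>

definition iter_int :: "'a measure \<Rightarrow> ('a \<Rightarrow> 'a) \<Rightarrow> int \<Rightarrow> 'a \<Rightarrow> 'a" where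
  "iter_int M T k = (if 0 \<le> k then T ^^ nat k else the_inv_into (space M) T ^^ nat (- k))"

definition invariant_sets :: "'a measure \<Rightarrow> ('a \<Rightarrow> 'a) \<Rightarrow> 'a set set" where
  "invariant_sets M T = {A \<in> sets M. T -` A \<inter> space M = A}"

definition invariant_algebra :: "'a measure \<Rightarrow> ('a \<Rightarrow> 'a) \<Rightarrow> 'a measure" where
  "invariant_algebra M T = sigma (space M) (invariant_sets M T)"

text \<open>The generating family is already a sigma-algebra, so nothing is added by \<^const>\<open>sigma\<close>.\<close>

lemma sigma_algebra_invariant_sets:
  assumes "T \<in> M \<rightarrow>\<^sub>M M"
  shows "sigma_algebra (space M) (invariant_sets M T)"
proof -
  have T: "T x \<in> space M" if "x \<in> space M" for x
    using assms that by (rule measurable_space)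
  have sub: "invariant_sets M T \<subseteq> Pow (space M)"
    using sets.sets_into_space by (auto simp: invariant_sets_def)
  have emp: "{} \<in> invariant_sets M T"
    by (auto simp: invariant_sets_def)
  have compl: "space M - A \<in> invariant_sets M T" if "A \<in> invariant_sets M T" for A
  proof -
    have A: "A \<in> sets M" "T -` A \<inter> space M = A"
      using that by (auto simp: invariant_sets_def)
    have "T -` (space M - A) \<inter> space M = space M - T -` A \<inter> space M"
      using T by auto
    also have "\<dots> = space M - A" using A(2) by blast
    finally show ?thesis using A(1) by (auto simp: invariant_sets_def)
  qed
  have un: "(\<Union>i. A i) \<in> invariant_sets M T"
    if "range A \<subseteq> invariant_sets M T" for A :: "nat \<Rightarrow> 'a set"
  proof -
    have A: "A i \<in> sets M" "T -` A i \<inter> space M = A i" for i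
      using that by (auto simp: invariant_sets_def)
    have "T -` (\<Union>i. A i) \<inter> space M = (\<Union>i. T -` A i \<inter> space M)" by auto
    also have "\<dots> = (\<Union>i. A i)" using A(2) by simp
    finally show ?thesis using A(1) by (auto simp: invariant_sets_def)
  qed
  show ?thesis
    unfolding sigma_algebra_iff2 using sub emp compl un by blast
qed

lemma sets_invariant_algebra:
  assumes "T \<in> M \<rightarrow>\<^sub>M M"
  shows "sets (invariant_algebra M T) = invariant_sets M T"
  unfolding invariant_algebra_def
  using sigma_algebra.sets_measure_of_eq[OF sigma_algebra_invariant_sets[OF assms]] by simp

lemma subalgebra_invariant_algebra:
  assumes "T \<in> M \<rightarrow>\<^sub>M M"
  shows "subalgebra M (invariant_algebra M T)"
  using sets_invariant_algebra[OF assms]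
  by (auto simp: subalgebra_def invariant_sets_def invariant_algebra_def space_measure_of_conv)

text \<open>The library's conditional expectation is for real functions; it is extended
  complex-linearly.\<close>

definition complex_cond_exp :: "'a measure \<Rightarrow> 'a measure \<Rightarrow> ('a \<Rightarrow> complex) \<Rightarrow> 'a \<Rightarrow> complex" where
  "complex_cond_exp M F f x =
     Complex (real_cond_exp M F (\<lambda>y. Re (f y)) x) (real_cond_exp M F (\<lambda>y. Im (f y)) x)"

definition L_infinity :: "'a measure \<Rightarrow> ('a \<Rightarrow> complex) set" where
  "L_infinity M = {f \<in> borel_measurable M. \<exists>C. AE x in M. norm (f x) \<le> C}"

text \<open>Only meaningful for square-integrable functions (the Bochner integral of a
  non-integrable function is 0); it is applied below to essentially bounded functions
  on a probability space.\<close>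

definition L2_dist :: "'a measure \<Rightarrow> ('a \<Rightarrow> complex) \<Rightarrow> ('a \<Rightarrow> complex) \<Rightarrow> real" where
  "L2_dist M u v = sqrt (LINT x|M. (norm (u x - v x))\<^sup>2)"

text \<open>Functions on a half-line are total functions on the reals of which only the values
  near infinity matter.  Enlarging the half-line makes one-sided derivatives at its
  endpoint irrelevant.\<close>

definition smooth_at_top :: "(real \<Rightarrow> real) \<Rightarrow> bool" where
  "smooth_at_top g \<longleftrightarrow>
     (\<exists>x0\<ge>0. \<forall>k. \<forall>x\<ge>x0. ((deriv ^^ k) g) differentiable (at x))"

definition eventually_monotone :: "(real \<Rightarrow> real) \<Rightarrow> bool" where
  "eventually_monotone h \<longleftrightarrow>
     (\<exists>x0\<ge>0. mono_on {x0..} h \<or> antimono_on {x0..} h)"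

definition Fejer :: "(real \<Rightarrow> real) \<Rightarrow> bool" where
  "Fejer g \<longleftrightarrow>
     (\<exists>x0\<ge>0. (\<forall>x\<ge>x0. g differentiable (at x)) \<and> continuous_on {x0..} (deriv g)) \<and>
     eventually_monotone (deriv g) \<and>
     (deriv g \<longlongrightarrow> 0) at_top \<and>
     filterlim (\<lambda>x. x * \<bar>deriv g x\<bar>) at_top at_top"

definition class_F :: "(real \<Rightarrow> real) set" where
  "class_F = {g. smooth_at_top g \<and> Fejer g \<and>
     (\<exists>\<alpha>. 0 < \<alpha> \<and> \<alpha> \<le> 1 \<and>
        ((\<lambda>x. x * deriv (deriv g) x / deriv g x) \<longlongrightarrow> \<alpha> - 1) at_top)}"

text \<open>\<open>slower g2 g1\<close> is the relation usually written \<open>g2 \<prec> g1\<close>.\<close>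

definition slower :: "(real \<Rightarrow> real) \<Rightarrow> (real \<Rightarrow> real) \<Rightarrow> bool" where
  "slower g2 g1 \<longleftrightarrow> filterlim (\<lambda>x. \<bar>g1 x\<bar> / \<bar>g2 x\<bar>) at_top at_top"

definition multiple_average ::
    "'a measure \<Rightarrow> nat \<Rightarrow> (nat \<Rightarrow> 'a \<Rightarrow> 'a) \<Rightarrow> (nat \<Rightarrow> 'a \<Rightarrow> complex) \<Rightarrow> (nat \<Rightarrow> real \<Rightarrow> real)
       \<Rightarrow> nat \<Rightarrow> 'a \<Rightarrow> complex" where
  "multiple_average M l T f g N x =
     1 / of_nat N * (\<Sum>n=1..N. \<Prod>i=1..l. f i (iter_int M (T i) \<lfloor>g i (real n)\<rfloor> x))"

end

theory Submission
  imports Defs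
begin

text \<open>If \<open>f\<^sub>1\<close> is a bounded coboundary \<open>h \<circ> T\<^sub>1 - h\<close>, the average tends to zero
  uniformly, for a purely arithmetic reason: \<open>[g\<^sub>1(n)]\<close> stays constant on blocks whose
  lengths, about \<open>1 / |g\<^sub>1'|\<close>, vary slowly, so summation by parts over these blocks
  leaves only the at most \<open>O(|g\<^sub>2(N)| + \<dots> + |g\<^sub>l(N)|)\<close> blocks on which one of the other
  factors jumps. They have length \<open>O(1 / |g\<^sub>1'(N)|)\<close>, and
  \<open>g\<^sub>1(x) / (x g\<^sub>1'(x)) \<rightarrow> 1 / \<alpha>\<close>, so they cover \<open>o(N)\<close> integers. By the ergodic theorem,
  \<open>f\<^sub>1\<close> is the sum of its conditional expectation, a bounded coboundary, and a function of
  small \<open>L\<^sup>1\<close> norm; the conditional expectation is invariant and factors out,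
  which permits induction on the number of transformations. As everything is bounded,
  convergence in \<open>L\<^sup>1\<close> and in \<open>L\<^sup>2\<close> are the same.\<close>

subsection \<open>Summation over the level sets of a concave sequence\<close>

text \<open>The fastest function is treated first because its level sets are the shortest: the
  number of jumps of the other factors, times the block length, has to be o(N). At a fixed point the
  other factors are just bounded sequences read at [g_i(n)], so only the number of their jumps
  matters. The estimate is uniform over such sequences, hence over all points, and no interplay of
  the transformations enters; in return, the bounds must hold at every point and not merely almost
  everywhere. Concavity alone would make the block lengths monotone, and their total variation would
  telescope. Rounding spoils this: a length may drop by up to 2 from one block to the next. The loss
  is O(1) per block, and the number of blocks, about |g_1(N)|, is o(N) because g_1' tends to 0.
  Decreasing functions are handled together with increasing ones by carrying the sign of the
  derivative along.\<close>

lemma sum_over_blocks: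
  fixes F :: "nat \<Rightarrow> 'b::ab_group_add"
  assumes "\<And>j. s j \<le> s (Suc j)" "s 0 = 0"
  shows "sum F {0..<s k} = (\<Sum>j<k. sum F {s j..<s (Suc j)})"
proof (induction k)
  case (Suc k)
  have "sum F {0..<s (Suc k)} = sum F {0..<s k} + sum F {s k..<s (Suc k)}"
    using assms by (simp add: sum.atLeastLessThan_concat)
  then show ?case using Suc by simp
qed (simp add: assms)

text \<open>Nothing is known of \<open>u\<close> beyond its bound, so the differences are moved onto
  \<open>c\<close>, at the cost of two boundary terms and the total variation of
  \<open>c\<close>.\<close>

lemma abel_summation_norm_bound:
  fixes u c :: "nat \<Rightarrow> complex"
  assumes u: "\<And>j. norm (u j) \<le> C"
  shows "norm (\<Sum>j\<le>k. (u (Suc j) - u j) * c j)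
    \<le> C * (norm (c k) + norm (c 0) + (\<Sum>j<k. norm (c (Suc j) - c j)))"
proof -
  have eq: "(\<Sum>j\<le>k. (u (Suc j) - u j) * c j)
      = u (Suc k) * c k - u 0 * c 0 - (\<Sum>j<k. u (Suc j) * (c (Suc j) - c j))"
    by (induction k) (simp_all add: algebra_simps)
  have "norm (\<Sum>j<k. u (Suc j) * (c (Suc j) - c j)) \<le> (\<Sum>j<k. C * norm (c (Suc j) - c j))"
    by (rule sum_norm_le) (simp add: norm_mult u mult_right_mono)
  moreover have "norm (u (Suc k) * c k) \<le> C * norm (c k)" "norm (u 0 * c 0) \<le> C * norm (c 0)"
    by (simp_all add: norm_mult u mult_right_mono)
  moreover have "norm (u (Suc k) * c k - u 0 * c 0 - (\<Sum>j<k. u (Suc j) * (c (Suc j) - c j)))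
     \<le> norm (u (Suc k) * c k) + norm (u 0 * c 0) + norm (\<Sum>j<k. u (Suc j) * (c (Suc j) - c j))"
    by (smt (verit) norm_triangle_ineq4)
  ultimately show ?thesis
    unfolding eq by (simp add: distrib_left sum_distrib_left)
qed

lemma increment_lower_bound:
  fixes G :: "nat \<Rightarrow> real"
  assumes "m \<le> n" "\<And>i. m \<le> i \<Longrightarrow> i < n \<Longrightarrow> d \<le> G (Suc i) - G i"
  shows "real (n - m) * d \<le> G n - G m"
  using assms
proof (induction n rule: dec_induct)
  case (step n)
  have "real (n - m) * d \<le> G n - G m" by (rule step.IH) (simp add: step.prems)
  moreover have "d \<le> G (Suc n) - G n" by (simp add: step.prems step.hyps)
  ultimately show ?case using step.hyps by (simp add: Suc_diff_le algebra_simps)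
qed simp

lemma norm_diff_le_variation:
  fixes b :: "nat \<Rightarrow> 'b::real_normed_vector"
  assumes "m \<le> n"
  shows "norm (b n - b m) \<le> (\<Sum>i\<in>{m..<n}. norm (b (Suc i) - b i))"
  using sum_Suc_diff'[OF assms, of b] norm_sum[of "\<lambda>i. b (Suc i) - b i" "{m..<n}"] by simp

text \<open>The sum is grouped into the level sets of \<open>k\<close>. By concavity of \<open>G\<close> their lengths
  are increasing up to rounding errors, so that Abel summation costs little.\<close>

lemma coboundary_sum_bound:
  fixes k :: "nat \<Rightarrow> nat" and G :: "nat \<Rightarrow> real" and u b :: "nat \<Rightarrow> complex"
  assumes k0: "k 0 = 0"
    and kG: "\<And>m n. m \<le> L \<Longrightarrow> n \<le> L \<Longrightarrow> \<bar>(real (k n) - real (k m)) - (G n - G m)\<bar> < 1"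
    and D: "D > 0" "\<And>n. n < L \<Longrightarrow> D \<le> G (Suc n) - G n"
    and concave: "\<And>m n. m \<le> n \<Longrightarrow> n < L \<Longrightarrow> G (Suc n) - G n \<le> G (Suc m) - G m"
    and u: "\<And>j. norm (u j) \<le> C"
    and b: "\<And>n. n \<le> L \<Longrightarrow> norm (b n) \<le> B"
  shows "norm (\<Sum>n\<le>L. (u (Suc (k n)) - u (k n)) * b n)
     \<le> C * (B * (4 * (1 + 1 / D) + 4 * real (k L))
           + 4 * (1 + 1 / D) * (\<Sum>n<L. norm (b (Suc n) - b n)))"
proof -
  \<comment> \<open>On a block \<open>G\<close> moves by less than 1 while each increment
    contributes at least \<open>D\<close>; hence \<open>1 + 1 / D\<close> will bound every block
    length.\<close>
  define W where "W = 1 + 1 / D"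
  have W0: "W > 0" using D by (simp add: W_def add_pos_pos)
  have C0: "C \<ge> 0" using u[of 0] norm_ge_zero order_trans by blast
  have B0: "B \<ge> 0" using b[of 0] norm_ge_zero order_trans by blast
  have kmono: "k m \<le> k n" if "m \<le> n" "n \<le> L" for m n
  proof -
    have "real (n - m) * 0 \<le> G n - G m"
    proof (rule increment_lower_bound[OF that(1)])
      show "0 \<le> G (Suc i) - G i" if "i < n" for i
        using D(1) D(2)[of i] that \<open>n \<le> L\<close> by simp
    qed
    then have "real (k n) - real (k m) > -1" using kG[of m n] that by auto
    then show ?thesis by linarith
  qed
  define K where "K = k L"
  \<comment> \<open>\<open>s j\<close> is the first index at which \<open>k\<close> has reached
    level \<open>j\<close>. The alternative \<open>L < n\<close> gives the value
    \<open>Suc L\<close> when the level is never reached. A level that \<open>k\<close> jumps over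
    yields an empty block.\<close>
  define s where "s j = (LEAST n. L < n \<or> j \<le> k n)" for j
  have s_prop: "L < s j \<or> j \<le> k (s j)" for j
    unfolding s_def by (rule LeastI[of _ "Suc L"]) simp
  have s_less: "n \<le> L" "k n < j" if "n < s j" for n j
    using not_less_Least[OF that[unfolded s_def]] by auto
  have s_gt: "n < s j" if "n \<le> L" "k n < j" for n j
  proof (rule ccontr)
    assume "\<not> n < s j"
    then show False using s_prop[of j] kmono[of "s j" n] that by auto
  qed
  have s_le: "s j \<le> Suc L" for j
    using s_less(1)[of "Suc L" j] by (cases "Suc L < s j") auto
  have s_mono: "s j \<le> s (Suc j)" for j
    using s_gt[of "s (Suc j)" j] s_less[of "s (Suc j)" j]  s_prop[of "Suc j"] s_le[of j]
    by (metis Suc_leD leD less_Suc_eq_le linorder_not_le order_less_le_trans)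
  have s0: "s 0 = 0" unfolding s_def by simp
  have sK: "s (Suc K) = Suc L"
    using s_le[of "Suc K"] s_gt[of L "Suc K"] by (simp add: K_def)
  have k_block: "k n = j" "n \<le> L" if "n \<in> {s j..<s (Suc j)}" for n j
  proof -
    show "n \<le> L" using that s_less(1)[of n "Suc j"] by auto
    have "k n < Suc j" using that s_less(2)[of n "Suc j"] by auto
    moreover have "\<not> k n < j" using that s_gt[of n j] \<open>n \<le> L\<close> by auto
    ultimately show "k n = j" by auto
  qed
  have s_le_L: "s j \<le> L" "j \<le> k (s j)" if "j \<le> K" for j
  proof -
    show "s j \<le> L"
      using s_less(2)[of L j] that by (cases "L < s j") (auto simp: K_def)
    then show "j \<le> k (s j)" using s_prop[of j] by auto
  qed
  define w where "w j = real (s (Suc j) - s j)" for j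
  define c where "c j = sum b {s j..<s (Suc j)}" for j
  have w0: "w j \<ge> 0" for j by (simp add: w_def)
  \<comment> \<open>A nonempty block with \<open>w j\<close> indices contains \<open>w j - 1\<close>
    increments of \<open>G\<close>, and their sum is below 1 because \<open>k\<close> agrees at both
    ends. Only increments inside the block enter, so \<open>d\<close> may be larger than
    \<open>D\<close>.\<close>
  have w_lt: "(w j - 1) * d < 1"
    if "0 < d" "\<And>n. n \<ge> s j \<Longrightarrow> Suc n < s (Suc j) \<Longrightarrow> d \<le> G (Suc n) - G n" for j d
  proof (cases "s j < s (Suc j)")
    case True
    define p where "p = s (Suc j) - 1"
    have p: "s j \<le> p" "p < s (Suc j)" "Suc p = s (Suc j)" using True by (auto simp: p_def)
    have "real (p - s j) * d \<le> G p - G (s j)"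
      using p that by (intro increment_lower_bound) auto
    moreover have "G p - G (s j) < 1"
      using kG[of "s j" p] k_block[of p j] k_block[of "s j" j] p by auto
    moreover have "w j - 1 = real (p - s j)" using p by (simp add: w_def of_nat_diff)
    ultimately show ?thesis by simp
  next
    case False
    then show ?thesis using \<open>0 < d\<close> by (simp add: w_def)
  qed
  have wW: "w j \<le> W" for j
  proof -
    have "(w j - 1) * D < 1"
    proof (rule w_lt)
      show "D \<le> G (Suc n) - G n" if "s j \<le> n" "Suc n < s (Suc j)" for n
        using that s_le[of "Suc j"] by (intro D(2)) simp
    qed (rule D(1))
    then show ?thesis using D(1) by (simp add: W_def field_simps)
  qed
  \<comment> \<open>The yardstick is the increment \<open>d\<close> of \<open>G\<close> that leads
    into block \<open>Suc j\<close>. Increments inside block \<open>j\<close> are at least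
    \<open>d\<close>, so \<open>(w j - 1) * d < 1\<close>. From \<open>p\<close>, one index before
    block \<open>Suc j\<close>, to its end \<open>q\<close>, \<open>k\<close> gains at least 2, so
    \<open>G\<close> gains more than 1 in \<open>w (Suc j) + 1\<close> increments of at most
    \<open>d\<close> each. Block \<open>K\<close> is excluded because it may be cut short at
    \<open>L\<close>.\<close>
  have w_almost_mono: "w j - 2 \<le> w (Suc j)" if "Suc j < K" for j
  proof -
    define p where "p = s (Suc j) - 1"
    have "0 < s (Suc j)" using s_gt[of 0 "Suc j"] k0 by simp
    then have p: "Suc p = s (Suc j)" by (simp add: p_def)
    have pL: "Suc p \<le> L" using s_le_L[of "Suc j"] that p by simp
    define d where "d = G (Suc p) - G p"
    have d0: "d > 0" unfolding d_def using D pL by (intro less_le_trans[OF D(1) D(2)]) simp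
    have 1: "(w j - 1) * d < 1"
    proof (rule w_lt[OF d0])
      show "d \<le> G (Suc n) - G n" if "s j \<le> n" "Suc n < s (Suc j)" for n
        using that concave[of n p] pL p by (auto simp: d_def)
    qed
    define q where "q = s (Suc (Suc j))"
    have q: "q \<le> L" "Suc (Suc j) \<le> k q" using s_le_L[of "Suc (Suc j)"] that by (auto simp: q_def)
    have kp: "k p \<le> j" using s_less(2)[of p "Suc j"] p by auto
    have pq: "Suc p \<le> q" using s_mono[of "Suc j"] by (simp add: p q_def)
    have "G q - G p > 1" using kG[of p q] q kp pL by (auto simp: abs_less_iff)
    moreover have "real (q - p) * (- d) \<le> (- G q) - (- G p)"
    proof (rule increment_lower_bound)
      show "- d \<le> - G (Suc i) - - G i" if "p \<le> i" "i < q" for i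
        using concave[of p i] that q by (auto simp: d_def)
    qed (use pq in simp)
    moreover have "real (q - p) = w (Suc j) + 1"
      using pq by (simp add: w_def q_def[symmetric] p[symmetric] of_nat_diff)
    ultimately have "(w j - 1) * d < (w (Suc j) + 1) * d" using 1 by simp
    then show ?thesis using d0 by simp
  qed
  have sum_w_diff: "(\<Sum>j<K. \<bar>w (Suc j) - w j\<bar>) \<le> 2 * W + 4 * real K"
  proof (cases K)
    case (Suc K')
    \<comment> \<open>A difference \<open>t \<ge> -2\<close> satisfies
      \<open>|t| \<le> t + 4\<close>, and the sum of \<open>t + 4\<close> telescopes. The last
      difference involves the possibly truncated block and is bounded by \<open>W\<close>
      separately.\<close>
    have "(\<Sum>j<K'. \<bar>w (Suc j) - w j\<bar>) \<le> (\<Sum>j<K'. w (Suc j) - w j + 4)"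
    proof (rule sum_mono)
      fix j assume "j \<in> {..<K'}"
      then show "\<bar>w (Suc j) - w j\<bar> \<le> w (Suc j) - w j + 4"
        using w_almost_mono[of j] Suc by auto
    qed
    also have "\<dots> = w K' - w 0 + 4 * real K'"
      by (simp add: sum.distrib sum_lessThan_telescope)
    finally have "(\<Sum>j<K'. \<bar>w (Suc j) - w j\<bar>) \<le> W + 4 * real K'"
      using wW[of K'] w0[of 0] by simp
    moreover have "\<bar>w (Suc K') - w K'\<bar> \<le> W"
      using wW[of K'] wW[of "Suc K'"] w0[of K'] w0[of "Suc K'"] by auto
    ultimately show ?thesis using Suc by simp
  qed (use W0 in simp)
  \<comment> \<open>Cutting off at \<open>L\<close> keeps \<open>b (Suc L)\<close>, of which nothing
    is assumed, out of the variation. The jump from the last index of a block into the next one is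
    counted in the block it leaves.\<close>
  define \<delta> where "\<delta> n = (if n < L then norm (b (Suc n) - b n) else 0)" for n
  define v where "v j = sum \<delta> {s j..<s (Suc j)}" for j
  have \<delta>0: "\<delta> n \<ge> 0" for n by (simp add: \<delta>_def)
  have v0: "v j \<ge> 0" for j by (simp add: v_def \<delta>0 sum_nonneg)
  have vv: "v j + v (Suc j) = sum \<delta> {s j..<s (Suc (Suc j))}" for j
    using s_mono[of j] s_mono[of "Suc j"] by (simp add: v_def sum.atLeastLessThan_concat)
  have sum_v: "(\<Sum>j<K. v j + v (Suc j)) \<le> 2 * (\<Sum>n<L. norm (b (Suc n) - b n))"
  proof -
    have "(\<Sum>j<K. v j) \<le> (\<Sum>j<Suc K. v j)"
      by (simp add: v0)
    moreover have "(\<Sum>j<K. v (Suc j)) \<le> (\<Sum>j<Suc K. v j)"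
      by (simp add: v0 sum.lessThan_Suc_shift del: sum.lessThan_Suc)
    moreover have "(\<Sum>j<Suc K. v j) = sum \<delta> {0..<Suc L}"
      unfolding v_def sK[symmetric] by (rule sum_over_blocks[OF s_mono s0, symmetric])
    moreover have "sum \<delta> {0..<Suc L} = (\<Sum>n<L. norm (b (Suc n) - b n))"
      by (simp add: \<delta>_def atLeast0LessThan)
    ultimately show ?thesis by (simp add: sum.distrib)
  qed
  have b_near: "norm (b n - b (s (Suc j))) \<le> v j + v (Suc j)"
    if j: "j < K" and n: "n \<in> {s j..<s (Suc (Suc j))}" for j n
  proof -
    have osc: "norm (b y - b x) \<le> v j + v (Suc j)"
      if "x \<le> y" "s j \<le> x" "y < s (Suc (Suc j))" for x y
    proof -
      have yL: "y \<le> L" using that s_le[of "Suc (Suc j)"] by simp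
      have "norm (b y - b x) \<le> (\<Sum>i\<in>{x..<y}. norm (b (Suc i) - b i))"
        by (rule norm_diff_le_variation[OF that(1)])
      also have "\<dots> = sum \<delta> {x..<y}" using yL by (intro sum.cong) (auto simp: \<delta>_def)
      also have "\<dots> \<le> sum \<delta> {s j..<s (Suc (Suc j))}"
        using that \<delta>0 by (intro sum_mono2) auto
      finally show ?thesis using vv by simp
    qed
    have sl: "s (Suc j) \<le> L" using s_le_L(1)[of "Suc j"] j by simp
    show ?thesis
    proof (cases "n \<le> s (Suc j)")
      case True
      show ?thesis
      proof (cases "n = s (Suc j)")
        case False
        then have "n < s (Suc j)" using True by simp
        show ?thesis
        proof (cases "s (Suc j) < s (Suc (Suc j))")
          case True
          then show ?thesis
            using osc[of n "s (Suc j)"] n \<open>n < s (Suc j)\<close> by (simp add: norm_minus_commute)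
        next
          case False
          \<comment> \<open>Block \<open>Suc j\<close> is empty here, so \<open>s (Suc j)\<close> is
            not an index of either block and \<open>osc\<close> does not apply; the jump to it is
            still counted at the last index of block \<open>j\<close>.\<close>
          then have e: "s (Suc (Suc j)) = s (Suc j)" using s_mono[of "Suc j"] by simp
          have "norm (b (s (Suc j)) - b n) \<le> (\<Sum>i\<in>{n..<s (Suc j)}. norm (b (Suc i) - b i))"
            by (rule norm_diff_le_variation) (use True in simp)
          also have "\<dots> = sum \<delta> {n..<s (Suc j)}" using sl by (intro sum.cong) (auto simp: \<delta>_def)
          also have "\<dots> \<le> sum \<delta> {s j..<s (Suc (Suc j))}"
            using n e \<delta>0 by (intro sum_mono2) auto
          finally show ?thesis using vv by (simp add: norm_minus_commute)
        qed
      qed (use v0 in simp)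
    next
      case False
      then show ?thesis using osc[of "s (Suc j)" n] n s_mono[of j] by simp
    qed
  qed
  have c_diff: "norm (c (Suc j) - c j) \<le> B * \<bar>w (Suc j) - w j\<bar> + 2 * W * (v j + v (Suc j))"
    if j: "j < K" for j
  proof -
    \<comment> \<open>Both block sums are compared with multiples of the one value
      \<open>\<beta>\<close> at their common boundary, so that only the difference of the two
      lengths is multiplied by \<open>B\<close>.\<close>
    define \<beta> where "\<beta> = b (s (Suc j))"
    have \<beta>: "norm \<beta> \<le> B" using b s_le_L(1)[of "Suc j"] j by (simp add: \<beta>_def)
    have near: "norm (c i - w i * \<beta>) \<le> W * (v j + v (Suc j))" if i: "i \<in> {j, Suc j}" for i
    proof -
      have "c i - w i * \<beta> = (\<Sum>n\<in>{s i..<s (Suc i)}. b n - \<beta>)"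
        by (simp add: c_def w_def sum_subtractf)
      also have "norm \<dots> \<le> (\<Sum>n\<in>{s i..<s (Suc i)}. v j + v (Suc j))"
      proof (rule sum_norm_le)
        fix n assume "n \<in> {s i..<s (Suc i)}"
        then have "n \<in> {s j..<s (Suc (Suc j))}"
          using i s_mono[of j] s_mono[of "Suc j"] by auto
        then show "norm (b n - \<beta>) \<le> v j + v (Suc j)" using b_near j by (simp add: \<beta>_def)
      qed
      also have "\<dots> = w i * (v j + v (Suc j))" by (simp add: w_def)
      also have "\<dots> \<le> W * (v j + v (Suc j))" using wW v0 by (intro mult_right_mono) auto
      finally show ?thesis .
    qed
    have "c (Suc j) - c j = (c (Suc j) - w (Suc j) * \<beta>) - (c j - w j * \<beta>)
        + complex_of_real (w (Suc j) - w j) * \<beta>"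
      by (simp add: algebra_simps)
    also have "norm \<dots> \<le> norm (c (Suc j) - w (Suc j) * \<beta>) + norm (c j - w j * \<beta>)
        + norm (complex_of_real (w (Suc j) - w j) * \<beta>)"
      by (smt (verit) norm_triangle_ineq4 norm_triangle_ineq)
    also have "norm (complex_of_real (w (Suc j) - w j) * \<beta>) \<le> B * \<bar>w (Suc j) - w j\<bar>"
      using \<beta> by (simp add: norm_mult mult.commute[of B] mult_left_mono del: of_real_diff)
    finally show ?thesis using near[of j] near[of "Suc j"] by (simp add: algebra_simps)
  qed
  have c_le: "norm (c j) \<le> B * W" for j
  proof -
    have "norm (c j) \<le> (\<Sum>n\<in>{s j..<s (Suc j)}. B)"
      unfolding c_def using k_block(2)[of _ j] b by (intro sum_norm_le) blast
    also have "\<dots> = B * w j" by (simp add: w_def)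
    also have "\<dots> \<le> B * W" using wW B0 by (rule mult_left_mono)
    finally show ?thesis .
  qed
  have "(\<Sum>n\<le>L. (u (Suc (k n)) - u (k n)) * b n)
      = (\<Sum>n\<in>{0..<s (Suc K)}. (u (Suc (k n)) - u (k n)) * b n)"
    by (simp add: sK atLeast0LessThan lessThan_Suc_atMost)
  also have "\<dots> = (\<Sum>j<Suc K. \<Sum>n\<in>{s j..<s (Suc j)}. (u (Suc (k n)) - u (k n)) * b n)"
    by (rule sum_over_blocks[OF s_mono s0])
  also have "\<dots> = (\<Sum>j<Suc K. (u (Suc j) - u j) * c j)"
    unfolding c_def sum_distrib_left by (intro sum.cong refl) (simp add: k_block(1))
  finally have "(\<Sum>n\<le>L. (u (Suc (k n)) - u (k n)) * b n) = (\<Sum>j\<le>K. (u (Suc j) - u j) * c j)"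
    by (simp only: lessThan_Suc_atMost)
  then have "norm (\<Sum>n\<le>L. (u (Suc (k n)) - u (k n)) * b n)
      \<le> C * (norm (c K) + norm (c 0) + (\<Sum>j<K. norm (c (Suc j) - c j)))"
    using abel_summation_norm_bound[OF u, where k = K and c = c] by simp
  \<comment> \<open>The boundary terms give \<open>2 * B * W\<close>, the variation of the lengths
    another \<open>B * (2 * W + 4 * K)\<close>. The variation of \<open>b\<close> enters each
    difference of \<open>c\<close> with weight \<open>2 * W\<close>, and each block occurs in two
    such differences, whence the second factor 2.\<close>
  also have "\<dots> \<le> C * (B * W + B * W + (B * (2 * W + 4 * real K)
      + 2 * W * (2 * (\<Sum>n<L. norm (b (Suc n) - b n)))))"
  proof (intro mult_left_mono add_mono c_le C0)
    have "(\<Sum>j<K. norm (c (Suc j) - c j))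
        \<le> (\<Sum>j<K. B * \<bar>w (Suc j) - w j\<bar> + 2 * W * (v j + v (Suc j)))"
      by (rule sum_mono) (simp add: c_diff)
    also have "\<dots> = B * (\<Sum>j<K. \<bar>w (Suc j) - w j\<bar>) + 2 * W * (\<Sum>j<K. v j + v (Suc j))"
      by (simp only: sum.distrib sum_distrib_left[symmetric])
    also have "\<dots> \<le> B * (2 * W + 4 * real K) + 2 * W * (2 * (\<Sum>n<L. norm (b (Suc n) - b n)))"
      using W0 B0 sum_w_diff sum_v by (intro add_mono mult_left_mono) auto
    finally show "(\<Sum>j<K. norm (c (Suc j) - c j)) \<le> \<dots>" .
  qed
  finally show ?thesis by (simp add: W_def[symmetric] K_def algebra_simps)
qed

subsection \<open>Growth of the functions in the class F\<close>

text \<open>\<open>\<sigma>\<close> is the sign of the derivative: \<open>\<sigma> * g\<close> is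
  increasing and concave from \<open>x0\<close> on, which covers decreasing \<open>g\<close> as
  well. It is an integer so that it can also multiply floors.\<close>

definition concave_from :: "int \<Rightarrow> real \<Rightarrow> (real \<Rightarrow> real) \<Rightarrow> bool" where
  "concave_from \<sigma> x0 g \<longleftrightarrow> \<bar>\<sigma>\<bar> = 1 \<and>
     (\<forall>x\<ge>x0. (g has_real_derivative deriv g x) (at x) \<and> 0 < \<sigma> * deriv g x) \<and>
     (\<forall>x y. x0 \<le> x \<longrightarrow> x \<le> y \<longrightarrow> \<sigma> * deriv g y \<le> \<sigma> * deriv g x)"

lemma concave_from_weaken: "concave_from \<sigma> x0 g \<Longrightarrow> x0 \<le> x1 \<Longrightarrow> concave_from \<sigma> x1 g"
  unfolding concave_from_def by (meson order_trans)

lemma concave_fromD: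
  assumes "concave_from \<sigma> x0 g"
  shows "\<sigma> = 1 \<or> \<sigma> = -1"
    and "\<And>x. x0 \<le> x \<Longrightarrow> (g has_real_derivative deriv g x) (at x)"
    and "\<And>x. x0 \<le> x \<Longrightarrow> 0 < \<sigma> * deriv g x"
    and "\<And>x y. x0 \<le> x \<Longrightarrow> x \<le> y \<Longrightarrow> \<sigma> * deriv g y \<le> \<sigma> * deriv g x"
  using assms unfolding concave_from_def by (auto simp: abs_if split: if_splits)

lemma concave_from_abs_deriv:
  assumes "concave_from \<sigma> x0 g" "x0 \<le> x"
  shows "\<bar>deriv g x\<bar> = \<sigma> * deriv g x"
  using concave_fromD(1,3)[OF assms(1)] assms(2) by fastforce

lemma concave_from_mvt:
  assumes c: "concave_from \<sigma> x0 g" and "x0 \<le> x" "x < y"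
  obtains z where "x < z" "z < y" "\<sigma> * g y - \<sigma> * g x = (y - x) * (\<sigma> * deriv g z)"
proof -
  have "\<exists>z. x < z \<and> z < y \<and> g y - g x = (y - x) * deriv g z"
    using assms(2,3) concave_fromD(2)[OF c] by (intro MVT2) auto
  then obtain z where z: "x < z" "z < y" "g y - g x = (y - x) * deriv g z" by blast
  show ?thesis
    by (rule that[OF z(1,2)]) (use z(3) in \<open>simp add: right_diff_distrib[symmetric]\<close>)
qed

lemma concave_from_mono:
  assumes c: "concave_from \<sigma> x0 g" and "x0 \<le> x" "x \<le> y"
  shows "\<sigma> * g x \<le> \<sigma> * g y"
proof (cases "x = y")
  case False
  then obtain z where "x < z" "\<sigma> * g y - \<sigma> * g x = (y - x) * (\<sigma> * deriv g z)"
    using concave_from_mvt[OF c assms(2)] assms(3) by (metis less_eq_real_def)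
  moreover have "0 < \<sigma> * deriv g z" using concave_fromD(3)[OF c] \<open>x < z\<close> assms(2) by simp
  ultimately show ?thesis using assms(3) by (smt (verit) mult_nonneg_nonneg)
qed simp

lemma concave_from_increment:
  assumes c: "concave_from \<sigma> x0 g" and "x0 \<le> x"
  shows "\<sigma> * deriv g (x + 1) \<le> \<sigma> * g (x + 1) - \<sigma> * g x"
    and "\<sigma> * g (x + 1) - \<sigma> * g x \<le> \<sigma> * deriv g x"
proof -
  obtain z where z: "x < z" "z < x + 1" "\<sigma> * g (x + 1) - \<sigma> * g x = (x + 1 - x) * (\<sigma> * deriv g z)"
    using concave_from_mvt[OF c assms(2), of "x + 1"] by auto
  show "\<sigma> * deriv g (x + 1) \<le> \<sigma> * g (x + 1) - \<sigma> * g x"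
    using z concave_fromD(4)[OF c, of z "x + 1"] assms(2) by simp
  show "\<sigma> * g (x + 1) - \<sigma> * g x \<le> \<sigma> * deriv g x"
    using z concave_fromD(4)[OF c, of x z] assms(2) by simp
qed

lemma concave_from_floor_mono:
  assumes c: "concave_from \<sigma> x0 g" and "x0 \<le> x" "x \<le> y"
  shows "\<sigma> * \<lfloor>g x\<rfloor> \<le> \<sigma> * \<lfloor>g y\<rfloor>"
  using concave_fromD(1)[OF c] concave_from_mono[OF assms] by (auto intro: floor_mono)

text \<open>A monotone derivative with limit 0 has a constant sign: it increases to 0 from below or
  decreases to 0 from above. It cannot vanish for large \<open>x\<close>, since
  \<open>x * |g' x|\<close> tends to infinity.\<close>

lemma class_F_concave_from:
  assumes "g \<in> class_F"
  obtains \<sigma> x0 where "concave_from \<sigma> x0 g"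
proof -
  have F: "Fejer g" using assms by (simp add: class_F_def)
  obtain x1 where x1: "\<And>x. x \<ge> x1 \<Longrightarrow> g differentiable (at x)"
    using F by (auto simp: Fejer_def)
  obtain x2 where x2: "mono_on {x2..} (deriv g) \<or> antimono_on {x2..} (deriv g)"
    using F by (auto simp: Fejer_def eventually_monotone_def)
  have lim: "(deriv g \<longlongrightarrow> 0) at_top" using F by (simp add: Fejer_def)
  have "\<forall>\<^sub>F x in at_top. 1 \<le> x * \<bar>deriv g x\<bar>"
    using F by (auto simp: Fejer_def filterlim_at_top)
  then obtain x3 where x3: "\<And>x. x \<ge> x3 \<Longrightarrow> 1 \<le> x * \<bar>deriv g x\<bar>"
    by (auto simp: eventually_at_top_linorder)
  then have nz: "deriv g x \<noteq> 0" if "x \<ge> x3" for x using that by fastforce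
  define x0 where "x0 = max x1 (max x2 x3)"
  have diff: "(g has_real_derivative deriv g x) (at x)" if "x \<ge> x0" for x
    using x1[of x] that by (simp add: x0_def DERIV_deriv_iff_real_differentiable)
  show ?thesis
  proof (cases "mono_on {x2..} (deriv g)")
    case True
    then have m: "deriv g x \<le> deriv g y" if "x0 \<le> x" "x \<le> y" for x y
      using that by (auto simp: monotone_on_def x0_def)
    have "deriv g x \<le> 0" if "x0 \<le> x" for x
    proof (rule tendsto_lowerbound[OF lim])
      show "\<forall>\<^sub>F y in at_top. deriv g x \<le> deriv g y"
        using m[OF that] by (auto simp: eventually_at_top_linorder)
    qed simp
    then have "deriv g x < 0" if "x0 \<le> x" for x using that nz[of x] by (force simp: x0_def)
    then have "concave_from (-1) x0 g" using m diff by (simp add: concave_from_def)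
    then show ?thesis by (rule that)
  next
    case False
    then have m: "deriv g y \<le> deriv g x" if "x0 \<le> x" "x \<le> y" for x y
      using that x2 by (auto simp: monotone_on_def x0_def)
    have "0 \<le> deriv g x" if "x0 \<le> x" for x
    proof (rule tendsto_upperbound[OF lim])
      show "\<forall>\<^sub>F y in at_top. deriv g y \<le> deriv g x"
        using m[OF that] by (auto simp: eventually_at_top_linorder)
    qed simp
    then have "0 < deriv g x" if "x0 \<le> x" for x using that nz[of x] by (force simp: x0_def)
    then have "concave_from 1 x0 g" using m diff by (simp add: concave_from_def)
    then show ?thesis by (rule that)
  qed
qed

text \<open>The number of blocks up to N is about \<open>|g N|\<close>, so this makes a bounded cost
  per block negligible.\<close>

lemma class_F_sublinear:
  assumes "g \<in> class_F"
  shows "((\<lambda>x. g x / x) \<longlongrightarrow> 0) at_top"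
proof -
  obtain \<sigma> x0 where c: "concave_from \<sigma> x0 g" using class_F_concave_from[OF assms] .
  show ?thesis
  proof (rule lhospital_at_top_at_top[where f' = "deriv g" and g' = "\<lambda>_. 1"])
    show "\<forall>\<^sub>F x in at_top. (g has_real_derivative deriv g x) (at x)"
      using concave_fromD(2)[OF c] by (auto simp: eventually_at_top_linorder)
    show "((\<lambda>x. deriv g x / 1) \<longlongrightarrow> 0) at_top"
      using assms by (simp add: class_F_def Fejer_def)
  qed (auto intro: filterlim_ident)
qed

text \<open>L'Hospital's rule: the derivative of \<open>x * g'\<close> is
  \<open>g' * (1 + x * g'' / g')\<close>, and the second factor tends to \<alpha>, so the limit is
  \<open>1 / \<alpha>\<close>, finite because \<alpha> > 0. The Fejer condition makes the
  denominator \<open>\<sigma> * (x * g')\<close> tend to infinity.\<close>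

lemma class_F_power_growth:
  assumes "g \<in> class_F"
  obtains c where "((\<lambda>x. g x / (x * deriv g x)) \<longlongrightarrow> c) at_top"
proof -
  obtain \<sigma> x0 where c: "concave_from \<sigma> x0 g" using class_F_concave_from[OF assms] .
  obtain \<alpha> where \<alpha>: "0 < \<alpha>" "((\<lambda>x. x * deriv (deriv g) x / deriv g x) \<longlongrightarrow> \<alpha> - 1) at_top"
    using assms by (auto simp: class_F_def)
  let ?q = "\<lambda>x. 1 + x * deriv (deriv g) x / deriv g x"
  have q: "(?q \<longlongrightarrow> \<alpha>) at_top" using tendsto_add[OF tendsto_const \<alpha>(2), of 1] by simp
  have ev: "\<forall>\<^sub>F x in at_top. x \<ge> x0" by (rule eventually_ge_at_top)
  have evq: "\<forall>\<^sub>F x in at_top. ?q x > 0" using order_tendstoD(1)[OF q \<alpha>(1)] .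
  have \<sigma>: "real_of_int \<sigma> \<noteq> 0" using concave_fromD(1)[OF c] by auto
  have nz: "deriv g x \<noteq> 0" if "x \<ge> x0" for x using concave_fromD(3)[OF c that] by auto
  obtain x1 where x1: "\<And>x. x \<ge> x1 \<Longrightarrow> deriv g differentiable (at x)"
  proof -
    obtain x1 where "\<forall>k. \<forall>x\<ge>x1. ((deriv ^^ k) g) differentiable (at x)"
      using assms by (auto simp: class_F_def smooth_at_top_def)
    from this[rule_format, of _ 1] show ?thesis by (intro that[of x1]) simp
  qed
  have split: "\<sigma> * (deriv g x + x * deriv (deriv g) x) = \<sigma> * deriv g x * ?q x" if "x \<ge> x0" for x
    using nz[OF that] by (simp add: field_simps)
  have "((\<lambda>x. (\<sigma> * g x) / (\<sigma> * (x * deriv g x))) \<longlongrightarrow> inverse \<alpha>) at_top"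
  proof (rule lhospital_at_top_at_top[where f' = "\<lambda>x. \<sigma> * deriv g x"
        and g' = "\<lambda>x. \<sigma> * (deriv g x + x * deriv (deriv g) x)"])
    have "filterlim (\<lambda>x. x * \<bar>deriv g x\<bar>) at_top at_top"
      using assms by (simp add: class_F_def Fejer_def)
    then show "filterlim (\<lambda>x. \<sigma> * (x * deriv g x)) at_top at_top"
    proof (rule filterlim_mono_eventually[OF _ order_refl order_refl])
      show "\<forall>\<^sub>F x in at_top. x * \<bar>deriv g x\<bar> = \<sigma> * (x * deriv g x)"
        using ev by eventually_elim (simp add: concave_from_abs_deriv[OF c])
    qed
    show "\<forall>\<^sub>F x in at_top. \<sigma> * (deriv g x + x * deriv (deriv g) x) \<noteq> 0"
      using ev evq by eventually_elim (use \<sigma> nz split in auto)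
    show "\<forall>\<^sub>F x in at_top. ((\<lambda>x. \<sigma> * g x) has_real_derivative \<sigma> * deriv g x) (at x)"
      using ev by eventually_elim (intro DERIV_cmult concave_fromD(2)[OF c])
    show "\<forall>\<^sub>F x in at_top. ((\<lambda>x. \<sigma> * (x * deriv g x)) has_real_derivative
        \<sigma> * (deriv g x + x * deriv (deriv g) x)) (at x)"
      using eventually_ge_at_top[of x1]
    proof eventually_elim
      case (elim x)
      have "(deriv g has_real_derivative deriv (deriv g) x) (at x)"
        using x1[OF elim] by (simp add: DERIV_deriv_iff_real_differentiable)
      then show ?case by (auto intro!: derivative_eq_intros)
    qed
    have "((\<lambda>x. inverse (?q x)) \<longlongrightarrow> inverse \<alpha>) at_top"
      using q \<alpha>(1) by (intro tendsto_inverse) auto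
    then show "((\<lambda>x. \<sigma> * deriv g x / (\<sigma> * (deriv g x + x * deriv (deriv g) x))) \<longlongrightarrow> inverse \<alpha>) at_top"
    proof (rule Lim_transform_eventually)
      show "\<forall>\<^sub>F x in at_top. inverse (?q x)
          = \<sigma> * deriv g x / (\<sigma> * (deriv g x + x * deriv (deriv g) x))"
        using ev
      proof eventually_elim
        case (elim x)
        show ?case unfolding split[OF elim] using nz[OF elim] \<sigma> by (simp add: inverse_eq_divide)
      qed
    qed
  qed
  then have "((\<lambda>x. g x / (x * deriv g x)) \<longlongrightarrow> inverse \<alpha>) at_top" using \<sigma> by simp
  then show ?thesis by (rule that)
qed

text \<open>About \<open>|h N|\<close> jumps, each spoiling blocks of length about
  \<open>1 / |g' N|\<close>, must together cover o(N) indices. The quotient is the product of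
  \<open>h / g\<close>, which tends to 0, and \<open>g / (x * g')\<close>, which converges.\<close>

lemma slower_over_derivative:
  assumes g: "g \<in> class_F" and h: "slower h g"
  shows "((\<lambda>x. h x / (x * deriv g x)) \<longlongrightarrow> 0) at_top"
proof -
  obtain c where c: "((\<lambda>x. g x / (x * deriv g x)) \<longlongrightarrow> c) at_top" using class_F_power_growth[OF g] .
  have "((\<lambda>x. inverse (\<bar>g x\<bar> / \<bar>h x\<bar>)) \<longlongrightarrow> 0) at_top"
    using h tendsto_inverse_0_at_top unfolding slower_def by blast
  then have "((\<lambda>x. \<bar>h x / g x\<bar>) \<longlongrightarrow> 0) at_top" by (simp add: abs_divide)
  then have "((\<lambda>x. h x / g x) \<longlongrightarrow> 0) at_top" by (rule tendsto_rabs_zero_cancel)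
  then have "((\<lambda>x. h x / g x * (g x / (x * deriv g x))) \<longlongrightarrow> 0 * c) at_top"
    by (rule tendsto_mult[OF _ c])
  then have "((\<lambda>x. h x / g x * (g x / (x * deriv g x))) \<longlongrightarrow> 0) at_top" by simp
  then show ?thesis
  proof (rule Lim_transform_eventually)
    \<comment> \<open>Division by zero yields 0, so a positive quotient shows that neither
      \<open>g x\<close> nor \<open>h x\<close> vanishes, and \<open>g x\<close> may be
      cancelled.\<close>
    have "\<forall>\<^sub>F x in at_top. \<bar>g x\<bar> / \<bar>h x\<bar> > 0"
      using h unfolding slower_def by (auto simp: filterlim_at_top_dense)
    then show "\<forall>\<^sub>F x in at_top. h x / g x * (g x / (x * deriv g x)) = h x / (x * deriv g x)"
      by eventually_elim auto
  qed
qed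

section \<open>Products of bounded factors\<close>

lemma norm_prod_le_power:
  fixes c :: "'i \<Rightarrow> complex"
  assumes "\<And>i. i \<in> I \<Longrightarrow> norm (c i) \<le> C"
  shows "norm (\<Prod>i\<in>I. c i) \<le> C ^ card I"
  unfolding prod_norm[symmetric] using prod_mono[of I "\<lambda>i. norm (c i)" "\<lambda>_. C"] assms by simp

text \<open>Integers that differ at all differ by at least 1, so the trivial bound
  \<open>2 * C ^ card I\<close> suffices. Applied to floors at consecutive times, the sum on the
  right counts jumps.\<close>

lemma prod_diff_norm_bound:
  fixes v :: "'i \<Rightarrow> int \<Rightarrow> complex"
  assumes I: "finite I" and v: "\<And>i m. i \<in> I \<Longrightarrow> norm (v i m) \<le> C"
  shows "norm ((\<Prod>i\<in>I. v i (a i)) - (\<Prod>i\<in>I. v i (b i))) \<le> 2 * C ^ card I * (\<Sum>i\<in>I. real_of_int \<bar>a i - b i\<bar>)"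
proof (cases "\<forall>i\<in>I. a i = b i")
  case True
  then have "(\<Prod>i\<in>I. v i (a i)) = (\<Prod>i\<in>I. v i (b i))" by (intro prod.cong) auto
  then show ?thesis using True by simp
next
  case False
  then obtain j where j: "j \<in> I" "a j \<noteq> b j" by blast
  then have "1 \<le> real_of_int \<bar>a j - b j\<bar>" by linarith
  also have "\<dots> \<le> (\<Sum>i\<in>I. real_of_int \<bar>a i - b i\<bar>)"
    by (rule member_le_sum[OF j(1)]) (use I in auto)
  finally have s: "1 \<le> (\<Sum>i\<in>I. real_of_int \<bar>a i - b i\<bar>)" .
  have P: "norm (\<Prod>i\<in>I. v i (c i)) \<le> C ^ card I" for c
    by (rule norm_prod_le_power) (rule v)
  then have P0: "0 \<le> 2 * C ^ card I" using order_trans[OF norm_ge_zero P] by simp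
  have "norm ((\<Prod>i\<in>I. v i (a i)) - (\<Prod>i\<in>I. v i (b i))) \<le> 2 * C ^ card I * 1"
    using norm_triangle_ineq4[of "\<Prod>i\<in>I. v i (a i)" "\<Prod>i\<in>I. v i (b i)"] P[of a] P[of b] by simp
  also have "\<dots> \<le> 2 * C ^ card I * (\<Sum>i\<in>I. real_of_int \<bar>a i - b i\<bar>)"
    by (rule mult_left_mono[OF s P0])
  finally show ?thesis .
qed

subsection \<open>Averages of coboundaries\<close>

text \<open>Levels are counted from the floor of \<open>g n0\<close> in the direction of \<sigma>,
  which turns the sum into one over natural levels with \<open>G = \<sigma> * g\<close> concave. Up
  to N every increment of \<open>G\<close> is at least \<open>|g' N|\<close>; the indices below
  \<open>n0\<close> are estimated trivially.\<close>

lemma coboundary_average_bound: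
  fixes v :: "'i \<Rightarrow> int \<Rightarrow> complex"
  assumes g: "concave_from \<sigma> (real n0) g"
    and n0: "1 \<le> n0"
    and I: "finite I" and h: "\<And>i. i \<in> I \<Longrightarrow> concave_from (\<tau> i) (real n0) (h i)"
    and u: "\<And>m. norm (u m) \<le> C" and v: "\<And>i m. i \<in> I \<Longrightarrow> norm (v i m) \<le> C"
    and N: "n0 \<le> N"
  defines "P \<equiv> C ^ card I"
  shows "norm (\<Sum>n=1..N. (u (\<lfloor>g (real n)\<rfloor> + 1) - u \<lfloor>g (real n)\<rfloor>) * (\<Prod>i\<in>I. v i \<lfloor>h i (real n)\<rfloor>))
    \<le> 2 * C * P * n0
      + C * (P * (4 * (1 + 1 / \<bar>deriv g N\<bar>) + 4 * (\<bar>g N - g n0\<bar> + 1))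
             + 4 * (1 + 1 / \<bar>deriv g N\<bar>) * (2 * P * (\<Sum>i\<in>I. \<bar>h i N - h i n0\<bar> + 1)))"
proof -
  define F where "F n = (u (\<lfloor>g (real n)\<rfloor> + 1) - u \<lfloor>g (real n)\<rfloor>) * (\<Prod>i\<in>I. v i \<lfloor>h i (real n)\<rfloor>)" for n :: nat
  define L where "L = N - n0"
  have NL: "N = n0 + L" using N by (simp add: L_def)
  have C0: "0 \<le> C" using order_trans[OF norm_ge_zero u] .
  have P0: "0 \<le> P" using C0 by (simp add: P_def)
  have prod_le: "norm (\<Prod>i\<in>I. v i (c i)) \<le> P" for c
    unfolding P_def by (rule norm_prod_le_power) (rule v)
  have F_le: "norm (F n) \<le> 2 * C * P" for n
    unfolding F_def norm_mult
    using u[of "\<lfloor>g n\<rfloor> + 1"] u[of "\<lfloor>g n\<rfloor>"] norm_triangle_ineq4[of "u (\<lfloor>g n\<rfloor> + 1)" "u \<lfloor>g n\<rfloor>"]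
    by (intro mult_mono prod_le) (use C0 in auto)
  note \<sigma> = concave_fromD(1)[OF g]
  define k where "k n = nat (\<sigma> * (\<lfloor>g (real (n0 + n))\<rfloor> - \<lfloor>g (real n0)\<rfloor>))" for n
  define G where "G n = \<sigma> * g (real (n0 + n))" for n
  \<comment> \<open>For decreasing \<open>g\<close> the sequence \<open>u\<close> is read backwards.
    With the shift by 1, \<open>u' (Suc j) - u' j\<close> is minus the forward difference of
    \<open>u\<close> at the level \<open>j\<close> below the floor of \<open>g n0\<close>; the
    factor \<sigma> in front of the sum restores the sign.\<close>
  define u' where "u' j = (if \<sigma> = 1 then u (\<lfloor>g (real n0)\<rfloor> + int j) else u (\<lfloor>g (real n0)\<rfloor> + 1 - int j))" for j
  define b where "b n = (\<Prod>i\<in>I. v i \<lfloor>h i (real (n0 + n))\<rfloor>)" for n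
  have k_int: "int (k n) = \<sigma> * (\<lfloor>g (real (n0 + n))\<rfloor> - \<lfloor>g (real n0)\<rfloor>)" for n
  proof -
    have "\<sigma> * \<lfloor>g (real n0)\<rfloor> \<le> \<sigma> * \<lfloor>g (real (n0 + n))\<rfloor>"
      by (rule concave_from_floor_mono[OF g]) auto
    then show ?thesis by (simp add: k_def right_diff_distrib)
  qed
  then have k_real: "real (k n) = \<sigma> * (\<lfloor>g (real (n0 + n))\<rfloor> - \<lfloor>g (real n0)\<rfloor>)" for n
    by (metis of_int_diff of_int_mult of_int_of_nat_eq)
  have G_inc: "\<sigma> * deriv g (real (n0 + Suc n)) \<le> G (Suc n) - G n"
    "G (Suc n) - G n \<le> \<sigma> * deriv g (real (n0 + n))" for n
    using concave_from_increment[OF g, of "real (n0 + n)"] by (simp_all add: G_def add_ac)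
  have main: "norm (\<Sum>n\<le>L. (u' (Suc (k n)) - u' (k n)) * b n)
     \<le> C * (P * (4 * (1 + 1 / \<bar>deriv g N\<bar>) + 4 * real (k L))
           + 4 * (1 + 1 / \<bar>deriv g N\<bar>) * (\<Sum>n<L. norm (b (Suc n) - b n)))"
  proof (rule coboundary_sum_bound[where G = G])
    show "k 0 = 0" by (simp add: k_def)
    show "\<bar>real (k n) - real (k m) - (G n - G m)\<bar> < 1" for m n
      using \<sigma> unfolding k_real G_def by (elim disjE) (simp_all, linarith+)
    show "0 < \<bar>deriv g N\<bar>" using concave_fromD(3)[OF g, of N] N by auto
    show "\<bar>deriv g N\<bar> \<le> G (Suc n) - G n" if "n < L" for n
      using concave_from_abs_deriv[OF g, of N] concave_fromD(4)[OF g, of "real (n0 + Suc n)" N]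
        G_inc(1)[of n] that NL by simp
    show "G (Suc n) - G n \<le> G (Suc m) - G m" if "m \<le> n" for m n
    proof (cases "m = n")
      case False
      then have "\<sigma> * deriv g (real (n0 + n)) \<le> \<sigma> * deriv g (real (n0 + Suc m))"
        using that by (intro concave_fromD(4)[OF g]) auto
      then show ?thesis using G_inc(1)[of m] G_inc(2)[of n] by linarith
    qed simp
    show "norm (u' j) \<le> C" for j using u by (simp add: u'_def)
    show "norm (b n) \<le> P" for n unfolding b_def by (rule prod_le)
  qed
  have "real (k L) = \<bar>real_of_int (\<lfloor>g N\<rfloor> - \<lfloor>g n0\<rfloor>)\<bar>"
    using \<sigma> k_real[of L] by (auto simp: NL[symmetric])
  then have kL: "real (k L) \<le> \<bar>g N - g n0\<bar> + 1" by linarith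
  \<comment> \<open>As \<open>h i\<close> is monotone, its floors move only in the direction
    \<open>\<tau> i\<close>, so their jumps telescope to the net change.\<close>
  have var: "(\<Sum>n<L. norm (b (Suc n) - b n)) \<le> 2 * P * (\<Sum>i\<in>I. \<bar>h i N - h i n0\<bar> + 1)"
  proof -
    have "(\<Sum>n<L. norm (b (Suc n) - b n)) \<le> (\<Sum>n<L. 2 * P * (\<Sum>i\<in>I.
        real_of_int \<bar>\<lfloor>h i (real (n0 + Suc n))\<rfloor> - \<lfloor>h i (real (n0 + n))\<rfloor>\<bar>))"
      unfolding b_def P_def by (intro sum_mono prod_diff_norm_bound I v)
    also have "\<dots> = 2 * P * (\<Sum>i\<in>I. \<Sum>n<L.
        real_of_int \<bar>\<lfloor>h i (real (n0 + Suc n))\<rfloor> - \<lfloor>h i (real (n0 + n))\<rfloor>\<bar>)"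
      unfolding sum_distrib_left by (rule sum.swap)
    also have "\<dots> \<le> 2 * P * (\<Sum>i\<in>I. \<bar>h i N - h i n0\<bar> + 1)"
    proof (intro mult_left_mono sum_mono)
      fix i assume i: "i \<in> I"
      note \<tau> = concave_fromD(1)[OF h[OF i]]
      have "real_of_int \<bar>\<lfloor>h i (real (n0 + Suc n))\<rfloor> - \<lfloor>h i (real (n0 + n))\<rfloor>\<bar>
          = real_of_int (\<tau> i * \<lfloor>h i (real (n0 + Suc n))\<rfloor>) - real_of_int (\<tau> i * \<lfloor>h i (real (n0 + n))\<rfloor>)" for n
      proof -
        have "\<tau> i * \<lfloor>h i (real (n0 + n))\<rfloor> \<le> \<tau> i * \<lfloor>h i (real (n0 + Suc n))\<rfloor>"
          by (rule concave_from_floor_mono[OF h[OF i]]) auto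
        then show ?thesis using \<tau> by auto
      qed
      then have "(\<Sum>n<L. real_of_int \<bar>\<lfloor>h i (real (n0 + Suc n))\<rfloor> - \<lfloor>h i (real (n0 + n))\<rfloor>\<bar>)
          = real_of_int (\<tau> i * \<lfloor>h i (real (n0 + L))\<rfloor>) - real_of_int (\<tau> i * \<lfloor>h i (real (n0 + 0))\<rfloor>)"
        by (simp only: sum_lessThan_telescope[of "\<lambda>n. real_of_int (\<tau> i * \<lfloor>h i (real (n0 + n))\<rfloor>)"])
      also have "\<dots> \<le> \<bar>h i N - h i n0\<bar> + 1"
        unfolding NL[symmetric] using \<tau> by (elim disjE) (simp_all, linarith+)
      finally show "(\<Sum>n<L. real_of_int \<bar>\<lfloor>h i (real (n0 + Suc n))\<rfloor> - \<lfloor>h i (real (n0 + n))\<rfloor>\<bar>)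
          \<le> \<bar>h i N - h i n0\<bar> + 1" .
    qed (use P0 in simp)
    finally show ?thesis .
  qed
  have "norm (\<Sum>n\<le>L. F (n0 + n)) = norm (\<Sum>n\<le>L. (u' (Suc (k n)) - u' (k n)) * b n)"
  proof -
    have "F (n0 + n) = \<sigma> * ((u' (Suc (k n)) - u' (k n)) * b n)" for n
    proof -
      have "\<lfloor>g (real (n0 + n))\<rfloor> = \<lfloor>g (real n0)\<rfloor> + \<sigma> * int (k n)"
        using \<sigma> k_int[of n] by auto
      then show ?thesis using \<sigma> unfolding F_def u'_def b_def by (auto simp: algebra_simps)
    qed
    then have "(\<Sum>n\<le>L. F (n0 + n)) = \<sigma> * (\<Sum>n\<le>L. (u' (Suc (k n)) - u' (k n)) * b n)"
      by (simp add: sum_distrib_left)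
    then show ?thesis using \<sigma> by (auto simp: norm_mult)
  qed
  also have "\<dots> \<le> C * (P * (4 * (1 + 1 / \<bar>deriv g N\<bar>) + 4 * (\<bar>g N - g n0\<bar> + 1))
             + 4 * (1 + 1 / \<bar>deriv g N\<bar>) * (2 * P * (\<Sum>i\<in>I. \<bar>h i N - h i n0\<bar> + 1)))"
    by (rule order_trans[OF main])
       (intro mult_left_mono add_mono kL var C0 P0 order_refl; simp)
  finally have 1: "norm (\<Sum>n\<le>L. F (n0 + n)) \<le> \<dots>" .
  have "(\<Sum>n=1..N. F n) = (\<Sum>n\<in>{1..<n0}. F n) + (\<Sum>n\<in>{n0..N}. F n)"
    using N n0 by (subst sum.union_disjoint[symmetric]) (auto intro!: sum.cong)
  also have "(\<Sum>n\<in>{n0..N}. F n) = (\<Sum>n\<le>L. F (n0 + n))"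
    using sum.shift_bounds_cl_nat_ivl[of F 0 n0 L] NL by (simp add: atMost_atLeast0 add_ac)
  finally have "norm (\<Sum>n=1..N. F n) \<le> norm (\<Sum>n\<in>{1..<n0}. F n) + norm (\<Sum>n\<le>L. F (n0 + n))"
    by (simp add: norm_triangle_ineq)
  moreover have "norm (\<Sum>n\<in>{1..<n0}. F n) \<le> real (card {1..<n0}) * (2 * C * P)"
    by (rule sum_norm_bound) (rule F_le)
  moreover have "\<dots> \<le> real n0 * (2 * C * P)"
    using C0 P0 by (intro mult_right_mono) auto
  ultimately show ?thesis using 1 unfolding F_def[symmetric] by (simp add: mult.commute[of "real n0"])
qed

text \<open>The threshold for N does not depend on \<open>u\<close> and \<open>v\<close>: these will
  be values along the orbits of a point, so the convergence is uniform in the point.\<close>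

lemma coboundary_average_vanishes:
  fixes h :: "'i \<Rightarrow> real \<Rightarrow> real"
  assumes g: "g \<in> class_F" and I: "finite I"
    and h: "\<And>i. i \<in> I \<Longrightarrow> h i \<in> class_F" and slow: "\<And>i. i \<in> I \<Longrightarrow> slower (h i) g"
    and \<epsilon>: "\<epsilon> > 0"
  shows "\<forall>\<^sub>F N in sequentially. \<forall>u v. (\<forall>m. norm (u m) \<le> C) \<longrightarrow> (\<forall>i\<in>I. \<forall>m. norm (v i m) \<le> C) \<longrightarrow>
    norm ((\<Sum>n=1..N. (u (\<lfloor>g (real n)\<rfloor> + 1) - u \<lfloor>g (real n)\<rfloor>) * (\<Prod>i\<in>I. v i \<lfloor>h i (real n)\<rfloor>)) / of_nat N :: complex) \<le> \<epsilon>"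
proof -
  obtain \<sigma> x0 where g0: "concave_from \<sigma> x0 g" using class_F_concave_from[OF g] .
  have "\<exists>\<tau> x. concave_from \<tau> x (h i)" if "i \<in> I" for i using class_F_concave_from[OF h[OF that]] by blast
  then obtain \<tau> x where h0: "concave_from (\<tau> i) (x i) (h i)" if "i \<in> I" for i by metis
  have "\<forall>\<^sub>F n in sequentially. 1 \<le> n \<and> x0 \<le> real n \<and> (\<forall>i\<in>I. x i \<le> real n)"
    by (intro eventually_conj eventually_ball_finite I ballI eventually_ge_at_top
        eventually_compose_filterlim[OF eventually_ge_at_top filterlim_real_sequentially])
  then obtain n0 where n0: "1 \<le> n0" "x0 \<le> real n0" "\<And>i. i \<in> I \<Longrightarrow> x i \<le> real n0"
    by (auto simp: eventually_sequentially)
  note g1 = concave_from_weaken[OF g0 n0(2)] and h1 = concave_from_weaken[OF h0 n0(3)]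
  define P where "P = C ^ card I"
  define D where "D x = \<bar>deriv g x\<bar>" for x
  define R where "R x = (\<Sum>i\<in>I. \<bar>h i x - h i n0\<bar> + 1)" for x
  \<comment> \<open>\<open>E\<close> is the bound of \<open>coboundary_average_bound\<close> with N
    replaced by a real variable, so that limits over the reals apply.\<close>
  define E where "E x = 2 * C * P * n0
      + C * (P * (4 * (1 + 1 / D x) + 4 * (\<bar>g x - g n0\<bar> + 1)) + 4 * (1 + 1 / D x) * (2 * P * R x))" for x :: real
  have inv: "((\<lambda>x :: real. 1 / x) \<longlongrightarrow> 0) at_top"
    using tendsto_inverse_0_at_top[OF filterlim_ident[of at_top]] by (simp add: inverse_eq_divide)
  have "filterlim (\<lambda>x. x * D x) at_top at_top" using g by (simp add: class_F_def Fejer_def D_def)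
  then have invD: "((\<lambda>x. 1 / (x * D x)) \<longlongrightarrow> 0) at_top"
    using tendsto_inverse_0_at_top by (fastforce simp: inverse_eq_divide)
  have over_x: "((\<lambda>x. \<bar>f x - c\<bar> / x) \<longlongrightarrow> 0) at_top" if "f \<in> class_F" for f c
  proof -
    have "((\<lambda>x. \<bar>f x / x - c * (1 / x)\<bar>) \<longlongrightarrow> 0) at_top"
      using tendsto_diff[OF class_F_sublinear[OF that] tendsto_mult[OF tendsto_const inv, of c]]
      by (intro tendsto_rabs_zero) simp
    then show ?thesis
    proof (rule Lim_transform_eventually)
      show "\<forall>\<^sub>F x in at_top. \<bar>f x / x - c * (1 / x)\<bar> = \<bar>f x - c\<bar> / x"
        using eventually_gt_at_top[of 0]
        by eventually_elim (simp add: abs_divide diff_divide_distrib[symmetric])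
    qed
  qed
  have R_x: "((\<lambda>x. R x / x) \<longlongrightarrow> 0) at_top"
    unfolding R_def sum_divide_distrib add_divide_distrib
    by (intro tendsto_null_sum tendsto_add_zero over_x h inv)
  \<comment> \<open>The decisive term: jumps of the slower functions times the block length,
    relative to \<open>x\<close>. This is where \<open>slow\<close> enters.\<close>
  have R_xD: "((\<lambda>x. R x / (x * D x)) \<longlongrightarrow> 0) at_top"
    unfolding R_def sum_divide_distrib add_divide_distrib
  proof (intro tendsto_null_sum tendsto_add_zero invD)
    fix i assume i: "i \<in> I"
    have "((\<lambda>x. \<bar>h i x / (x * deriv g x)\<bar> + \<bar>h i n0\<bar> * (1 / (x * D x))) \<longlongrightarrow> 0) at_top"
      using slower_over_derivative[OF g slow[OF i]]
      by (intro tendsto_add_zero tendsto_rabs_zero tendsto_mult_right_zero invD)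
    then show "((\<lambda>x. \<bar>h i x - h i n0\<bar> / (x * D x)) \<longlongrightarrow> 0) at_top"
    proof (rule tendsto_sandwich[OF _ _ tendsto_const, rotated 2])
      show "\<forall>\<^sub>F x in at_top. 0 \<le> \<bar>h i x - h i n0\<bar> / (x * D x)"
        using eventually_gt_at_top[of 0] by eventually_elim (simp add: D_def)
      show "\<forall>\<^sub>F x in at_top. \<bar>h i x - h i n0\<bar> / (x * D x)
          \<le> \<bar>h i x / (x * deriv g x)\<bar> + \<bar>h i n0\<bar> * (1 / (x * D x))"
        using eventually_gt_at_top[of 0]
      proof eventually_elim
        case (elim x)
        have "\<bar>h i x - h i n0\<bar> / (x * D x) \<le> (\<bar>h i x\<bar> + \<bar>h i n0\<bar>) / (x * D x)"
          using elim by (intro divide_right_mono) (auto simp: D_def)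
        then show ?case using elim by (simp add: D_def abs_divide abs_mult add_divide_distrib)
      qed
    qed
  qed
  have "((\<lambda>x. 2 * C * P * n0 * (1 / x)
      + C * (P * (4 * (1 / x + 1 / (x * D x)) + 4 * (\<bar>g x - g n0\<bar> / x + 1 / x))
             + 8 * P * (R x / x + R x / (x * D x)))) \<longlongrightarrow> 0) at_top"
    by (intro tendsto_add_zero tendsto_mult_right_zero inv invD R_x R_xD over_x g)
  then have "((\<lambda>x. E x / x) \<longlongrightarrow> 0) at_top"
    by (simp add: E_def add_divide_distrib distrib_left mult_ac)
  then have "\<forall>\<^sub>F x in at_top. E x / x < \<epsilon>" using \<epsilon> by (rule order_tendstoD(2))
  then have "\<forall>\<^sub>F N in sequentially. E (real N) / real N < \<epsilon>"
    by (rule eventually_compose_filterlim[OF _ filterlim_real_sequentially])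
  then show ?thesis
    using eventually_ge_at_top[of n0]
  proof eventually_elim
    case (elim N)
    show ?case
    proof (intro allI impI)
      fix u :: "int \<Rightarrow> complex" and v :: "'i \<Rightarrow> int \<Rightarrow> complex"
      assume u: "\<forall>m. norm (u m) \<le> C" and v: "\<forall>i\<in>I. \<forall>m. norm (v i m) \<le> C"
      have "norm (\<Sum>n=1..N. (u (\<lfloor>g (real n)\<rfloor> + 1) - u \<lfloor>g (real n)\<rfloor>) * (\<Prod>i\<in>I. v i \<lfloor>h i (real n)\<rfloor>)) \<le> E N"
        unfolding E_def D_def R_def P_def
        by (rule coboundary_average_bound[OF g1 n0(1) I h1 _ _ elim(2)]) (use u v in auto)
      then have "norm (\<Sum>n=1..N. (u (\<lfloor>g (real n)\<rfloor> + 1) - u \<lfloor>g (real n)\<rfloor>) * (\<Prod>i\<in>I. v i \<lfloor>h i (real n)\<rfloor>)) / N \<le> E N / N"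
        by (rule divide_right_mono) simp
      then show "norm ((\<Sum>n=1..N. (u (\<lfloor>g (real n)\<rfloor> + 1) - u \<lfloor>g (real n)\<rfloor>) * (\<Prod>i\<in>I. v i \<lfloor>h i (real n)\<rfloor>)) / of_nat N) \<le> \<epsilon>"
        using elim(1) by (simp add: norm_divide)
    qed
  qed
qed

subsection \<open>The pointwise ergodic theorem\<close>

lemma measure_preserving_mapD:
  assumes "measure_preserving_map M T"
  shows "T \<in> M \<rightarrow>\<^sub>M M" "distr M M T = M"
proof -
  show T: "T \<in> M \<rightarrow>\<^sub>M M" using assms by (simp add: measure_preserving_map_def)
  show "distr M M T = M"
    using assms by (intro measure_eqI) (auto simp: measure_preserving_map_def emeasure_distr)
qed

lemma measure_preserving_mapI:
  assumes "T \<in> M \<rightarrow>\<^sub>M M" "distr M M T = M"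
  shows "measure_preserving_map M T"
  using assms by (auto simp: measure_preserving_map_def simp flip: emeasure_distr)

lemma integrable_measure_preserving:
  fixes f :: "'a \<Rightarrow> 'b::{banach, second_countable_topology}"
  assumes "measure_preserving_map M T" "integrable M f"
  shows "integrable M (\<lambda>x. f (T x))"
  using integrable_distr[of T M M f] measure_preserving_mapD[OF assms(1)] assms(2) by simp

lemma integral_measure_preserving:
  fixes f :: "'a \<Rightarrow> 'b::{banach, second_countable_topology}"
  assumes "measure_preserving_map M T" "f \<in> borel_measurable M"
  shows "(LINT x|M. f (T x)) = integral\<^sup>L M f"
  using integral_distr[of T M M f] measure_preserving_mapD[OF assms(1)] assms(2) by simp

lemma AE_measure_preserving:
  assumes "measure_preserving_map M T" "AE x in M. P x"
  shows "AE x in M. P (T x)"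
  using AE_distrD[of T M M P] measure_preserving_mapD[OF assms(1)] assms(2) by metis

lemma measure_preserving_map_funpow:
  assumes "measure_preserving_map M T"
  shows "measure_preserving_map M (T ^^ n)"
proof (induction n)
  case 0
  show ?case
    by (rule measure_preserving_mapI) (auto intro: measurable_ident simp: id_def distr_id)
next
  case (Suc n)
  note T = measure_preserving_mapD[OF assms] and Tn = measure_preserving_mapD[OF Suc]
  show ?case
  proof (rule measure_preserving_mapI)
    show "T ^^ Suc n \<in> M \<rightarrow>\<^sub>M M" using measurable_comp[OF Tn(1) T(1)] by simp
    show "distr M M (T ^^ Suc n) = M"
      using distr_distr[OF T(1) Tn(1)] T(2) Tn(2) by (simp add: comp_def)
  qed
qed

text \<open>The algebra consists of sets that equal their preimage exactly, and the level set of
  \<open>e\<close> through \<open>x\<close> is one of them. Hence invariance holds at every point,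
  as the pointwise estimates require.\<close>

lemma measurable_invariant_algebra_invariant:
  fixes e :: "'a \<Rightarrow> real"
  assumes T: "T \<in> M \<rightarrow>\<^sub>M M" and e: "e \<in> borel_measurable (invariant_algebra M T)"
    and x: "x \<in> space M"
  shows "e (T x) = e x"
proof -
  have sp: "space (invariant_algebra M T) = space M"
    using subalgebra_invariant_algebra[OF T] by (simp add: subalgebra_def)
  have "e -` {e x} \<inter> space M \<in> invariant_sets M T"
    using measurable_sets[OF e, of "{e x}"] sets_invariant_algebra[OF T] sp by simp
  then have "T -` (e -` {e x} \<inter> space M) \<inter> space M = e -` {e x} \<inter> space M"
    by (simp add: invariant_sets_def)
  then show ?thesis using x by blast
qed

section \<open>The maximal ergodic inequality\<close>

text \<open>\<open>max_birkhoff T f n x\<close> is the maximum of the first \<open>n + 1\<close> Birkhoff sums of \<open>f\<close> at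
  \<open>x\<close>, starting with the empty sum.\<close>

primrec max_birkhoff :: "('a \<Rightarrow> 'a) \<Rightarrow> ('a \<Rightarrow> real) \<Rightarrow> nat \<Rightarrow> 'a \<Rightarrow> real" where
  "max_birkhoff T f 0 = (\<lambda>x. 0)"
| "max_birkhoff T f (Suc n) = (\<lambda>x. max 0 (f x + max_birkhoff T f n (T x)))"

lemma max_birkhoff_nonneg: "max_birkhoff T f n x \<ge> 0"
  by (cases n) auto

lemma birkhoff_sum_le_max_birkhoff: "(\<Sum>i<n. f ((T ^^ i) x)) \<le> max_birkhoff T f n x"
proof (induction n arbitrary: x)
  case (Suc n)
  have "(\<Sum>i<Suc n. f ((T ^^ i) x)) = f x + (\<Sum>i<n. f ((T ^^ i) (T x)))"
    by (simp add: sum.lessThan_Suc_shift funpow_swap1 del: sum.lessThan_Suc)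
  then show ?case using Suc[of "T x"] by simp
qed simp

lemma max_birkhoff_mono: "max_birkhoff T f n x \<le> max_birkhoff T f (Suc n) x"
proof (induction n arbitrary: x)
  case (Suc n)
  show ?case using Suc[of "T x"] by (auto simp: max_def)
qed simp

lemma integrable_max_birkhoff:
  assumes "measure_preserving_map M T" "integrable M f"
  shows "integrable M (max_birkhoff T f n)"
proof (induction n)
  case (Suc n)
  have "integrable M (\<lambda>x. max_birkhoff T f n (T x))"
    by (rule integrable_measure_preserving[OF assms(1) Suc])
  then show ?case using assms(2) by simp
qed simp

text \<open>This is the set where the Birkhoff sums are unbounded above. Natural thresholds
  \<open>m\<close> keep it a countable combination of measurable sets.\<close>

definition divergence_set :: "'a measure \<Rightarrow> ('a \<Rightarrow> 'a) \<Rightarrow> ('a \<Rightarrow> real) \<Rightarrow> 'a set" where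
  "divergence_set M T f = {x \<in> space M. \<forall>m::nat. \<exists>n. real m < max_birkhoff T f n x}"

text \<open>Once positive, \<open>max_birkhoff T f (Suc n) x\<close> differs from
  \<open>max_birkhoff T f n (T x)\<close> by exactly \<open>f x\<close>, so unboundedness passes
  between \<open>x\<close> and \<open>T x\<close> in both directions.\<close>

lemma divergence_set_invariant:
  assumes T: "measure_preserving_map M T" and f: "integrable M f"
  shows "divergence_set M T f \<in> invariant_sets M T"
proof -
  note [measurable] = measure_preserving_mapD(1)[OF T]
    borel_measurable_integrable[OF integrable_max_birkhoff[OF T f]]
  have meas: "divergence_set M T f \<in> sets M" unfolding divergence_set_def by measurable
  have "T x \<in> divergence_set M T f \<longleftrightarrow> x \<in> divergence_set M T f" if x: "x \<in> space M" for x
  proof -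
    have Tx: "T x \<in> space M" using x by (rule measurable_space[OF measure_preserving_mapD(1)[OF T]])
    have "(\<forall>m::nat. \<exists>n. real m < max_birkhoff T f n (T x))
        \<longleftrightarrow> (\<forall>m::nat. \<exists>n. real m < max_birkhoff T f n x)"
    proof (intro iffI allI)
      fix m :: nat
      assume h: "\<forall>m::nat. \<exists>n. real m < max_birkhoff T f n (T x)"
      obtain m' :: nat where m': "real m - f x \<le> real m'" using real_arch_simple by blast
      obtain n where "real m' < max_birkhoff T f n (T x)" using h by blast
      then have "real m < max_birkhoff T f (Suc n) x" using m' by simp
      then show "\<exists>n. real m < max_birkhoff T f n x" ..
    next
      fix m :: nat
      assume h: "\<forall>m::nat. \<exists>n. real m < max_birkhoff T f n x"
      obtain m' :: nat where m': "real m + \<bar>f x\<bar> \<le> real m'" using real_arch_simple by blast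
      obtain n where n: "real m' < max_birkhoff T f n x" using h by blast
      then have "n \<noteq> 0" by (intro notI) simp
      then obtain n' where "n = Suc n'" by (cases n) auto
      then have "real m < max_birkhoff T f n' (T x)" using n m' by (auto simp: max_def split: if_splits)
      then show "\<exists>n. real m < max_birkhoff T f n (T x)" ..
    qed
    then show ?thesis using x Tx by (simp add: divergence_set_def)
  qed
  then have "T -` divergence_set M T f \<inter> space M = divergence_set M T f"
    using sets.sets_into_space[OF meas] by auto
  then show ?thesis using meas by (simp add: invariant_sets_def)
qed

text \<open>On the set, \<open>?P n (T x)\<close> eventually exceeds \<open>|f x|\<close>, and then
  \<open>?P (Suc n) x - ?P n (T x)\<close> equals \<open>f x\<close>. By invariance of the set and
  of the measure, the integral of this difference over the set is that of
  \<open>?P (Suc n) - ?P n\<close>, which is nonnegative; dominated convergence concludes.\<close>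

lemma integral_divergence_set_nonneg:
  assumes T: "measure_preserving_map M T" and f: "integrable M f"
  shows "0 \<le> (LINT x|M. indicator (divergence_set M T f) x * f x)"
proof -
  let ?D = "divergence_set M T f" and ?P = "max_birkhoff T f"
  have D: "?D \<in> invariant_sets M T" by (rule divergence_set_invariant[OF T f])
  then have Dm [measurable]: "?D \<in> sets M" by (simp add: invariant_sets_def)
  note [measurable] = measure_preserving_mapD(1)[OF T] borel_measurable_integrable[OF f]
    borel_measurable_integrable[OF integrable_max_birkhoff[OF T f]]
  have int: "integrable M (\<lambda>x. indicator ?D x * ?P n x)" for n
    using integrable_mult_indicator[OF Dm integrable_max_birkhoff[OF T f, of n]] by simp
  have ind_T: "indicator ?D (T x) = (indicator ?D x :: real)" if "x \<in> space M" for x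
    using D that by (auto simp: invariant_sets_def indicator_def)
  have intT: "integrable M (\<lambda>x. indicator ?D x * ?P n (T x))" for n
    using integrable_measure_preserving[OF T int[of n]]
    by (rule Bochner_Integration.integrable_cong[THEN iffD1, rotated 2]) (simp_all add: ind_T)
  have eqT: "(LINT x|M. indicator ?D x * ?P n (T x)) = (LINT x|M. indicator ?D x * ?P n x)" for n
    unfolding integral_measure_preserving[OF T borel_measurable_integrable[OF int[of n]], symmetric]
    by (rule Bochner_Integration.integral_cong) (simp_all add: ind_T)
  let ?d = "\<lambda>n x. indicator ?D x * (?P (Suc n) x - ?P n (T x))"
  have "0 \<le> (LINT x|M. ?d n x)" for n
  proof -
    have "(LINT x|M. indicator ?D x * ?P n x) \<le> (LINT x|M. indicator ?D x * ?P (Suc n) x)"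
      by (intro integral_mono int mult_left_mono max_birkhoff_mono) simp
    then show ?thesis using int[of "Suc n"] intT[of n] eqT[of n] by (simp add: right_diff_distrib)
  qed
  moreover have "(\<lambda>n. LINT x|M. ?d n x) \<longlonglongrightarrow> (LINT x|M. indicator ?D x * f x)"
  proof (rule integral_dominated_convergence[where w = "\<lambda>x. \<bar>f x\<bar>"])
    show "AE x in M. (\<lambda>n. ?d n x) \<longlonglongrightarrow> indicator ?D x * f x"
    proof (rule AE_I2)
      fix x assume x: "x \<in> space M"
      show "(\<lambda>n. ?d n x) \<longlonglongrightarrow> indicator ?D x * f x"
      proof (cases "x \<in> ?D")
        case True
        then have TD: "T x \<in> ?D" using D x by (auto simp: invariant_sets_def)
        obtain m :: nat where m: "\<bar>f x\<bar> \<le> real m" using real_arch_simple by blast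
        obtain n0 where n0: "real m < ?P n0 (T x)" using TD by (auto simp: divergence_set_def)
        have "?P n0 (T x) \<le> ?P n (T x)" if "n0 \<le> n" for n
          using that by (rule lift_Suc_mono_le[of "\<lambda>n. ?P n (T x)", OF max_birkhoff_mono])
        then have "?d n x = f x" if "n0 \<le> n" for n using that n0 m True by (fastforce simp: max_def)
        then have "\<forall>\<^sub>F n in sequentially. ?d n x = f x" by (auto simp: eventually_sequentially)
        then show ?thesis using True by (simp add: tendsto_eventually)
      qed simp
    qed
    show "AE x in M. norm (?d n x) \<le> \<bar>f x\<bar>" for n
    proof (rule AE_I2)
      fix x
      \<comment> \<open>With \<open>p = ?P n (T x) \<ge> 0\<close> the bracket in \<open>?d\<close>
        equals \<open>max (- p) (f x)\<close>, whose absolute value is at most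
        \<open>|f x|\<close>.\<close>
      show "norm (?d n x) \<le> \<bar>f x\<bar>"
        using max_birkhoff_nonneg[of T f n "T x"] by (auto simp: indicator_def max_def)
    qed
    show "integrable M (\<lambda>x. \<bar>f x\<bar>)" using f by simp
  qed measurable
  ultimately show ?thesis by (intro LIMSEQ_le_const) auto
qed

lemma sigma_finite_invariant_algebra:
  assumes "prob_space M" "measure_preserving_map M T"
  shows "sigma_finite_subalgebra M (invariant_algebra M T)"
proof -
  interpret prob_space M by fact
  show ?thesis
    by (rule finite_measure_subalgebra_is_sigma_finite)
       (simp add: finite_measure_subalgebra_def finite_measure_subalgebra_axioms_def
         finite_measure_axioms subalgebra_invariant_algebra[OF measure_preserving_mapD(1)[OF assms(2)]])
qed

lemma real_cond_exp_invariant_funpow: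
  assumes T: "measure_preserving_map M T" and x: "x \<in> space M"
  shows "real_cond_exp M (invariant_algebra M T) f ((T ^^ i) x) = real_cond_exp M (invariant_algebra M T) f x"
proof (induction i)
  case (Suc i)
  have "(T ^^ i) x \<in> space M"
    using measurable_space[OF measure_preserving_mapD(1)[OF measure_preserving_map_funpow[OF T]] x] .
  then show ?case
    using measurable_invariant_algebra_invariant[OF measure_preserving_mapD(1)[OF T]
        borel_measurable_cond_exp] Suc by simp
qed simp

text \<open>The function \<open>h\<close> has conditional expectation
  \<open>- \<epsilon> / 2\<close>, so its integral over the invariant divergence set is
  \<open>- \<epsilon> / 2\<close> times the measure of that set; being nonnegative, it forces the
  set to be null. Elsewhere the sums of \<open>h\<close> are bounded by some \<open>m\<close>, which
  the other half of \<epsilon> absorbs for \<open>n \<ge> 2 * m / \<epsilon>\<close>.\<close>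

lemma birkhoff_upper_bound:
  fixes f :: "'a \<Rightarrow> real"
  assumes M: "prob_space M" and T: "measure_preserving_map M T" and f: "integrable M f"
    and \<epsilon>: "\<epsilon> > 0"
  shows "AE x in M. \<forall>\<^sub>F n in sequentially.
    (\<Sum>i<n. f ((T ^^ i) x)) / n \<le> real_cond_exp M (invariant_algebra M T) f x + \<epsilon>"
proof -
  interpret prob_space M by (rule M)
  interpret sigma_finite_subalgebra M "invariant_algebra M T"
    by (rule sigma_finite_invariant_algebra[OF M T])
  let ?e = "real_cond_exp M (invariant_algebra M T) f"
  define h where "h x = f x - ?e x - \<epsilon> / 2" for x
  have e: "integrable M ?e" by (rule real_cond_exp_int(1)[OF f])
  have h: "integrable M h" unfolding h_def using e f by simp
  let ?D = "divergence_set M T h"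
  have D: "?D \<in> invariant_sets M T" by (rule divergence_set_invariant[OF T h])
  then have Dm [measurable]: "?D \<in> sets M" by (simp add: invariant_sets_def)
  have DF: "?D \<in> sets (invariant_algebra M T)"
    using D sets_invariant_algebra[OF measure_preserving_mapD(1)[OF T]] by simp
  have ife: "integrable M (\<lambda>x. indicator ?D x * f x)" "integrable M (\<lambda>x. indicator ?D x * ?e x)"
    using integrable_mult_indicator[OF Dm f] integrable_mult_indicator[OF Dm e] by simp_all
  have ind: "integrable M (indicator ?D :: 'a \<Rightarrow> real)"
    by (rule integrable_real_indicator[OF Dm]) (simp add: less_top[symmetric])
  have "0 \<le> (LINT x|M. indicator ?D x * h x)"
    by (rule integral_divergence_set_nonneg[OF T h])
  also have "\<dots> = (LINT x|M. indicator ?D x * f x - indicator ?D x * ?e x - indicator ?D x * (\<epsilon> / 2))"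
    by (simp add: h_def right_diff_distrib)
  also have "\<dots> = (LINT x|M. indicator ?D x * f x) - (LINT x|M. indicator ?D x * ?e x)
      - measure M ?D * (\<epsilon> / 2)"
    using ife ind by simp
  also have "(LINT x|M. indicator ?D x * f x) = (LINT x|M. indicator ?D x * ?e x)"
    using real_cond_exp_intA[OF f DF] by (simp add: set_lebesgue_integral_def)
  finally have "measure M ?D \<le> 0" using \<epsilon> by (simp add: mult_le_0_iff)
  then have "emeasure M ?D = 0" by (simp add: emeasure_eq_measure measure_le_0_iff)
  then have "AE x in M. x \<notin> ?D" using Dm by (intro AE_not_in) (simp add: null_sets_def)
  then show ?thesis
  proof (rule AE_mp, intro AE_I2 impI)
    fix x assume x: "x \<in> space M" and "x \<notin> ?D"
    then obtain m :: nat where m: "max_birkhoff T h n x \<le> real m" for n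
      by (auto simp: divergence_set_def not_less)
    obtain n0 :: nat where n0: "real m * 2 / \<epsilon> \<le> real n0" using real_arch_simple by blast
    show "\<forall>\<^sub>F n in sequentially. (\<Sum>i<n. f ((T ^^ i) x)) / n \<le> ?e x + \<epsilon>"
    proof (rule eventually_sequentiallyI[of "Suc n0"])
      fix n assume n: "Suc n0 \<le> n"
      have "(\<Sum>i<n. h ((T ^^ i) x)) = (\<Sum>i<n. f ((T ^^ i) x)) - n * ?e x - n * (\<epsilon> / 2)"
        by (simp add: h_def sum_subtractf real_cond_exp_invariant_funpow[OF T x])
      moreover have "(\<Sum>i<n. h ((T ^^ i) x)) \<le> real m"
        by (rule order_trans[OF birkhoff_sum_le_max_birkhoff m])
      moreover have "real m \<le> n * (\<epsilon> / 2)"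
      proof -
        have "real m * 2 / \<epsilon> \<le> real n" using n0 n by linarith
        then show ?thesis using \<epsilon> by (simp add: field_simps)
      qed
      ultimately have "(\<Sum>i<n. f ((T ^^ i) x)) \<le> n * (?e x + \<epsilon>)" by (simp add: algebra_simps)
      then show "(\<Sum>i<n. f ((T ^^ i) x)) / n \<le> ?e x + \<epsilon>"
        using n by (simp add: divide_le_eq mult.commute)
    qed
  qed
qed

text \<open>The upper bound is used for \<open>f\<close> and for \<open>- f\<close>; countably many
  tolerances \<open>1 / Suc m\<close> keep the exceptional set null.\<close>

theorem birkhoff_ergodic:
  fixes f :: "'a \<Rightarrow> real"
  assumes M: "prob_space M" and T: "measure_preserving_map M T" and f: "integrable M f"
  shows "AE x in M. (\<lambda>n. (\<Sum>i<n. f ((T ^^ i) x)) / n)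
    \<longlonglongrightarrow> real_cond_exp M (invariant_algebra M T) f x"
proof -
  let ?e = "real_cond_exp M (invariant_algebra M T)"
  interpret sigma_finite_subalgebra M "invariant_algebra M T"
    by (rule sigma_finite_invariant_algebra[OF M T])
  have "AE x in M. ?e (\<lambda>x. - f x) x = - ?e f x"
    using real_cond_exp_cmult[OF f, of "-1"] by simp
  moreover have "AE x in M. \<forall>m. \<forall>\<^sub>F n in sequentially.
      (\<Sum>i<n. f ((T ^^ i) x)) / n \<le> ?e f x + 1 / Suc m"
    unfolding AE_all_countable by (intro allI birkhoff_upper_bound[OF M T f]) simp
  moreover have "AE x in M. \<forall>m. \<forall>\<^sub>F n in sequentially.
      (\<Sum>i<n. - f ((T ^^ i) x)) / n \<le> ?e (\<lambda>x. - f x) x + 1 / Suc m"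
    unfolding AE_all_countable
    using f by (intro allI birkhoff_upper_bound[OF M T, of "\<lambda>x. - f x"]) simp_all
  ultimately show ?thesis
  proof eventually_elim
    fix x
    assume neg: "?e (\<lambda>x. - f x) x = - ?e f x"
      and up: "\<forall>m. \<forall>\<^sub>F n in sequentially. (\<Sum>i<n. f ((T ^^ i) x)) / n \<le> ?e f x + 1 / Suc m"
      and lo: "\<forall>m. \<forall>\<^sub>F n in sequentially.
        (\<Sum>i<n. - f ((T ^^ i) x)) / n \<le> ?e (\<lambda>x. - f x) x + 1 / Suc m"
    show "(\<lambda>n. (\<Sum>i<n. f ((T ^^ i) x)) / n) \<longlonglongrightarrow> ?e f x"
    proof (rule tendstoI)
      fix \<epsilon> :: real assume "\<epsilon> > 0"
      then obtain m where m: "1 / Suc m < \<epsilon>"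
        using reals_Archimedean by (auto simp: inverse_eq_divide)
      show "\<forall>\<^sub>F n in sequentially. dist ((\<Sum>i<n. f ((T ^^ i) x)) / n) (?e f x) < \<epsilon>"
        using up[rule_format, of m] lo[rule_format, of m]
        by eventually_elim (use m neg in \<open>auto simp: dist_real_def sum_negf abs_less_iff\<close>)
    qed
  qed
qed

subsection \<open>Multiple averages\<close>

lemma invertible_mptD:
  assumes "invertible_mpt M T"
  shows "measure_preserving_map M T" "measure_preserving_map M (the_inv_into (space M) T)"
    and "\<And>x. x \<in> space M \<Longrightarrow> T (the_inv_into (space M) T x) = x"
proof -
  let ?S = "the_inv_into (space M) T"
  have T: "measure_preserving_map M T" and bij: "bij_betw T (space M) (space M)"
    and S: "?S \<in> M \<rightarrow>\<^sub>M M"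
    using assms by (auto simp: invertible_mpt_def)
  show "measure_preserving_map M T" by fact
  show TS: "\<And>x. x \<in> space M \<Longrightarrow> T (?S x) = x"
    using bij by (rule f_the_inv_into_f_bij_betw)
  have ST: "?S (T x) = x" if "x \<in> space M" for x
    using bij that by (auto simp: bij_betw_def intro: the_inv_into_f_f)
  show "measure_preserving_map M ?S"
    unfolding measure_preserving_map_def
  proof (intro conjI S ballI)
    fix A assume A: "A \<in> sets M"
    let ?B = "?S -` A \<inter> space M"
    have "?B \<in> sets M" by (rule measurable_sets[OF S A])
    then have "emeasure M ?B = emeasure M (T -` ?B \<inter> space M)"
      using T by (auto simp: measure_preserving_map_def simp del: vimage_Int)
    also have "T -` ?B \<inter> space M = A"
      using ST sets.sets_into_space[OF A] measurable_space[OF measure_preserving_mapD(1)[OF T]] by auto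
    finally show "emeasure M ?B = emeasure M A" .
  qed
qed

lemma iter_int_measure_preserving:
  "invertible_mpt M T \<Longrightarrow> measure_preserving_map M (iter_int M T k)"
  unfolding iter_int_def by (auto intro: measure_preserving_map_funpow invertible_mptD)

lemma iter_int_add_one:
  assumes T: "invertible_mpt M T" and x: "x \<in> space M"
  shows "iter_int M T (k + 1) x = T (iter_int M T k x)"
proof (cases "0 \<le> k")
  case True
  then show ?thesis by (simp add: iter_int_def nat_add_distrib)
next
  case False
  let ?S = "the_inv_into (space M) T"
  define n where "n = nat (- k - 1)"
  have k: "nat (- k) = Suc n" using False by (simp add: n_def)
  have "(?S ^^ n) x \<in> space M"
    using measurable_space[OF measure_preserving_mapD(1)[OF measure_preserving_map_funpow[OF
      invertible_mptD(2)[OF T]]] x] .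
  then have "T (iter_int M T k x) = (?S ^^ n) x"
    using False k invertible_mptD(3)[OF T] by (simp add: iter_int_def)
  also have "\<dots> = iter_int M T (k + 1) x"
  \<comment> \<open>At \<open>k = -1\<close> the definition of \<open>iter_int\<close> changes its
    branch; both sides are then zeroth powers.\<close>
  proof (cases "k = -1")
    case False
    then have "\<not> 0 \<le> k + 1" using \<open>\<not> 0 \<le> k\<close> by simp
    moreover have "nat (- (k + 1)) = n" by (simp add: n_def)
    ultimately show ?thesis by (simp add: iter_int_def del: minus_add_distrib)
  qed (simp add: iter_int_def n_def)
  finally show ?thesis ..
qed

lemma iter_int_invariant:
  assumes T: "invertible_mpt M T" and x: "x \<in> space M"
    and e: "\<And>x. x \<in> space M \<Longrightarrow> e (T x) = e x"
  shows "e (iter_int M T k x) = e x"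
proof -
  have step: "e (iter_int M T (k + 1) x) = e (iter_int M T k x)" for k
    unfolding iter_int_add_one[OF T x]
    by (rule e)
       (rule measurable_space[OF measure_preserving_mapD(1)[OF iter_int_measure_preserving[OF T]] x])
  show ?thesis
  proof (induction k rule: int_induct[of _ 0])
    case base
    show ?case by (simp add: iter_int_def)
  next
    case (step1 i)
    then show ?case using step[of i] by simp
  next
    case (step2 i)
    then show ?case using step[of "i - 1"] by simp
  qed
qed

section \<open>Invariant part, coboundary and small remainder\<close>

lemma complex_birkhoff_ergodic:
  fixes f :: "'a \<Rightarrow> complex"
  assumes "prob_space M" and T: "measure_preserving_map M T" and f: "integrable M f"
  shows "AE x in M. (\<lambda>n. (\<Sum>i<n. f ((T ^^ i) x)) / of_nat n)
    \<longlonglongrightarrow> complex_cond_exp M (invariant_algebra M T) f x"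
proof -
  have "integrable M (\<lambda>x. Re (f x))" "integrable M (\<lambda>x. Im (f x))"
    using f by (auto intro: integrable_Re integrable_Im)
  from this[THEN birkhoff_ergodic[OF assms(1) T]] show ?thesis
  proof eventually_elim
    case (elim x)
    have "(\<Sum>i<n. f ((T ^^ i) x)) / of_nat n
        = Complex ((\<Sum>i<n. Re (f ((T ^^ i) x))) / n) ((\<Sum>i<n. Im (f ((T ^^ i) x))) / n)" for n
      by (rule complex_eqI) (simp_all add: Re_divide_of_nat Im_divide_of_nat)
    then show ?case using tendsto_Complex[OF elim] by (simp add: complex_cond_exp_def)
  qed
qed

text \<open>Subtracting a long Birkhoff average from \<open>f\<close> leaves an exact coboundary.\<close>

lemma coboundary_decomposition:
  fixes f e :: "'a \<Rightarrow> complex"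
  assumes "prob_space M" and T: "measure_preserving_map M T"
    and f: "f \<in> borel_measurable M" "\<And>x. norm (f x) \<le> C"
    and e: "e \<in> borel_measurable M"
    and lim: "AE x in M. (\<lambda>n. (\<Sum>i<n. f ((T ^^ i) x)) / of_nat n) \<longlonglongrightarrow> e x"
    and \<epsilon>: "\<epsilon> > 0"
  obtains h r C' where "\<And>x. norm (h x) \<le> C'" "integrable M r" "(LINT x|M. norm (r x)) < \<epsilon>"
    "\<And>x. f x = e x + (h (T x) - h x) + r x"
proof -
  interpret prob_space M by fact
  note [measurable] = f(1) e measure_preserving_mapD(1)[OF measure_preserving_map_funpow[OF T]]
  have C0: "0 \<le> C" using order_trans[OF norm_ge_zero f(2)] .
  define A where "A n x = (\<Sum>i<n. f ((T ^^ i) x)) / of_nat n" for n x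
  have A_meas [measurable]: "A n \<in> borel_measurable M" for n unfolding A_def by measurable
  have A_le: "norm (A n x) \<le> C" for n x
  proof -
    have "norm (\<Sum>i<n. f ((T ^^ i) x)) \<le> real (card {..<n}) * C"
      by (rule sum_norm_bound) (rule f(2))
    then show ?thesis using C0 by (cases "n = 0") (simp_all add: A_def norm_divide field_simps)
  qed
  have lim': "AE x in M. (\<lambda>n. A n x) \<longlonglongrightarrow> e x" using lim by (simp add: A_def)
  have e_le: "AE x in M. norm (e x) \<le> C"
    using lim' by eventually_elim (rule Lim_norm_ubound[OF _ _ always_eventually], auto simp: A_le)
  have int: "integrable M (\<lambda>x. A n x - e x)" for n
  proof (rule integrable_const_bound[where B = "2 * C"])
    show "AE x in M. norm (A n x - e x) \<le> 2 * C"
      using e_le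
    proof eventually_elim
      case (elim x)
      then show ?case using norm_triangle_ineq4[of "A n x" "e x"] A_le[of n x] by linarith
    qed
  qed measurable
  have "(\<lambda>n. LINT x|M. norm (A n x - e x)) \<longlonglongrightarrow> (LINT x|M. 0)"
  proof (rule integral_dominated_convergence[where w = "\<lambda>_. 2 * C"])
    show "AE x in M. (\<lambda>n. norm (A n x - e x)) \<longlonglongrightarrow> 0"
      using lim' by eventually_elim (simp add: tendsto_norm_zero LIM_zero)
    show "AE x in M. norm (norm (A n x - e x)) \<le> 2 * C" for n
      using e_le
    proof eventually_elim
      case (elim x)
      then show ?case using norm_triangle_ineq4[of "A n x" "e x"] A_le[of n x] by simp
    qed
  qed simp_all
  then have "\<forall>\<^sub>F n in sequentially. (LINT x|M. norm (A n x - e x)) < \<epsilon>"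
    using \<epsilon> by (intro order_tendstoD(2)) simp_all
  then have "\<forall>\<^sub>F n in sequentially. 0 < n \<and> (LINT x|M. norm (A n x - e x)) < \<epsilon>"
    using eventually_gt_at_top[of 0] by eventually_elim simp
  then obtain n where n: "0 < n" "(LINT x|M. norm (A n x - e x)) < \<epsilon>"
    by (auto simp: eventually_sequentially)
  \<comment> \<open>With \<open>S_j\<close> for the Birkhoff sum of length j,
    \<open>f - f o T^j = - (S_j o T - S_j)\<close>; averaging over \<open>j < n\<close> gives
    \<open>f - A n = h o T - h\<close>.\<close>
  define h where "h x = - (\<Sum>j<n. \<Sum>i<j. f ((T ^^ i) x)) / of_nat n" for x
  show ?thesis
  proof (rule that[of h "\<Sum>j<n. real j * C" "\<lambda>x. A n x - e x"])
    show "norm (h x) \<le> (\<Sum>j<n. real j * C)" for x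
    proof -
      have "norm (\<Sum>j<n. \<Sum>i<j. f ((T ^^ i) x)) \<le> (\<Sum>j<n. real j * C)"
      proof (rule sum_norm_le)
        show "norm (\<Sum>i<j. f ((T ^^ i) x)) \<le> real j * C" for j
          using sum_norm_bound[of "{..<j}" "\<lambda>i. f ((T ^^ i) x)" C] f(2) by simp
      qed
      moreover have "norm (h x) \<le> norm (\<Sum>j<n. \<Sum>i<j. f ((T ^^ i) x)) / 1"
        unfolding h_def norm_divide norm_minus_cancel using n by (intro divide_left_mono) auto
      ultimately show ?thesis by simp
    qed
    show "integrable M (\<lambda>x. A n x - e x)" by (rule int)
    show "(LINT x|M. norm (A n x - e x)) < \<epsilon>" by (rule n(2))
    show "f x = e x + (h (T x) - h x) + (A n x - e x)" for x
    proof -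
      have tele: "(\<Sum>i<j. f ((T ^^ i) (T x))) - (\<Sum>i<j. f ((T ^^ i) x)) = f ((T ^^ j) x) - f x" for j
        using sum_lessThan_telescope[of "\<lambda>i. f ((T ^^ i) x)" j]
        by (simp add: sum_subtractf funpow_swap1)
      have "h (T x) - h x = - (\<Sum>j<n. f ((T ^^ j) x) - f x) / of_nat n"
        unfolding h_def tele[symmetric] sum_subtractf by (simp add: diff_divide_distrib)
      also have "\<dots> = f x - A n x"
        using n(1) by (simp add: sum_subtractf A_def field_simps)
      finally show ?thesis by simp
    qed
  qed
qed

text \<open>A general index set lets a single index be split off and the induction start from the
  empty product.\<close>

definition prod_average ::
    "'a measure \<Rightarrow> 'i set \<Rightarrow> ('i \<Rightarrow> 'a \<Rightarrow> 'a) \<Rightarrow> ('i \<Rightarrow> 'a \<Rightarrow> complex) \<Rightarrow> ('i \<Rightarrow> real \<Rightarrow> real)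
       \<Rightarrow> nat \<Rightarrow> 'a \<Rightarrow> complex" where
  "prod_average M I T f g N x =
     (\<Sum>n=1..N. \<Prod>i\<in>I. f i (iter_int M (T i) \<lfloor>g i (real n)\<rfloor> x)) / of_nat N"

lemma prod_average_measurable:
  assumes "\<And>i. i \<in> I \<Longrightarrow> invertible_mpt M (T i)" "\<And>i. i \<in> I \<Longrightarrow> f i \<in> borel_measurable M"
  shows "prod_average M I T f g N \<in> borel_measurable M"
proof -
  have "(\<lambda>x. f i (iter_int M (T i) k x)) \<in> borel_measurable M" if "i \<in> I" for i k
    by (rule measurable_compose[OF measure_preserving_mapD(1)[OF iter_int_measure_preserving] assms(2)])
       (use assms(1) that in auto)
  then show ?thesis unfolding prod_average_def
    by (intro borel_measurable_divide borel_measurable_sum borel_measurable_prod borel_measurable_const)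
qed

lemma prod_average_norm_le:
  assumes "\<And>i x. i \<in> I \<Longrightarrow> norm (f i x) \<le> C" "0 \<le> C"
  shows "norm (prod_average M I T f g N x) \<le> C ^ card I"
proof (cases "N = 0")
  case False
  have "norm (\<Sum>n=1..N. \<Prod>i\<in>I. f i (iter_int M (T i) \<lfloor>g i (real n)\<rfloor> x)) \<le> real (card {1..N}) * C ^ card I"
    by (intro sum_norm_bound norm_prod_le_power assms)
  then show ?thesis using False by (simp add: prod_average_def norm_divide field_simps)
qed (simp add: prod_average_def assms)

lemma integrable_prod_average_error:
  assumes M: "prob_space M"
    and T: "\<And>i. i \<in> I \<Longrightarrow> invertible_mpt M (T i)"
    and f: "\<And>i. i \<in> I \<Longrightarrow> f i \<in> borel_measurable M" "\<And>i x. i \<in> I \<Longrightarrow> norm (f i x) \<le> C"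
    and e: "\<And>i. i \<in> I \<Longrightarrow> e i \<in> borel_measurable M" "\<And>i x. i \<in> I \<Longrightarrow> norm (e i x) \<le> C"
    and C: "0 \<le> C"
  shows "norm (prod_average M I T f g N x - (\<Prod>i\<in>I. e i x)) \<le> 2 * C ^ card I"
    and "integrable M (\<lambda>x. norm (prod_average M I T f g N x - (\<Prod>i\<in>I. e i x)))"
proof -
  interpret prob_space M by fact
  have le: "norm (prod_average M I T f g N x - (\<Prod>i\<in>I. e i x)) \<le> 2 * C ^ card I" for x
    using norm_triangle_ineq4[of "prod_average M I T f g N x" "\<Prod>i\<in>I. e i x"]
      prod_average_norm_le[where I = I and f = f and M = M and T = T and g = g and N = N and x = x, OF f(2) C]
      norm_prod_le_power[where I = I and c = "\<lambda>i. e i x", OF e(2)] by linarith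
  then show "norm (prod_average M I T f g N x - (\<Prod>i\<in>I. e i x)) \<le> 2 * C ^ card I" .
  show "integrable M (\<lambda>x. norm (prod_average M I T f g N x - (\<Prod>i\<in>I. e i x)))"
  proof (rule integrable_const_bound[where B = "2 * C ^ card I"])
    show "(\<lambda>x. norm (prod_average M I T f g N x - (\<Prod>i\<in>I. e i x))) \<in> borel_measurable M"
    proof -
      have "prod_average M I T f g N \<in> borel_measurable M"
        by (rule prod_average_measurable) (use T f in auto)
      moreover have "(\<lambda>x. \<Prod>i\<in>I. e i x) \<in> borel_measurable M"
        by (intro borel_measurable_prod e)
      ultimately show ?thesis by measurable
    qed
  qed (use le in simp)
qed

text \<open>Here \<open>a\<close> carries the fastest function. The invariant part
  \<open>e a\<close> is constant along the orbit and leaves the sum, so \<open>IH\<close> applies to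
  it; the coboundary part vanishes uniformly; the remainder is estimated in mean, since every power
  of \<open>T a\<close> preserves the integral of its norm and the product of the other factors is
  at most \<open>P\<close>.\<close>

lemma prod_average_insert:
  fixes f e :: "'i \<Rightarrow> 'a \<Rightarrow> complex"
  assumes M: "prob_space M" and I: "finite I" "a \<notin> I"
    and T: "\<And>i. i \<in> insert a I \<Longrightarrow> invertible_mpt M (T i)"
    and f: "\<And>i. i \<in> insert a I \<Longrightarrow> f i \<in> borel_measurable M"
      "\<And>i x. i \<in> insert a I \<Longrightarrow> norm (f i x) \<le> C"
    and e: "\<And>i. i \<in> insert a I \<Longrightarrow> e i \<in> borel_measurable M"
      "\<And>i x. i \<in> insert a I \<Longrightarrow> norm (e i x) \<le> C"
    and e_inv: "\<And>x. x \<in> space M \<Longrightarrow> e a (T a x) = e a x"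
    and lim: "AE x in M. (\<lambda>n. (\<Sum>i<n. f a ((T a ^^ i) x)) / of_nat n) \<longlonglongrightarrow> e a x"
    and g: "\<And>i. i \<in> insert a I \<Longrightarrow> g i \<in> class_F" and slow: "\<And>i. i \<in> I \<Longrightarrow> slower (g i) (g a)"
    and IH: "(\<lambda>N. LINT x|M. norm (prod_average M I T f g N x - (\<Prod>i\<in>I. e i x))) \<longlonglongrightarrow> 0"
  shows "(\<lambda>N. LINT x|M. norm (prod_average M (insert a I) T f g N x - (\<Prod>i\<in>insert a I. e i x))) \<longlonglongrightarrow> 0"
proof (rule tendstoI)
  interpret prob_space M by fact
  fix \<epsilon> :: real assume \<epsilon>: "\<epsilon> > 0"
  have C0: "0 \<le> C" using order_trans[OF norm_ge_zero f(2)] by blast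
  define P where "P = C ^ card I"
  have P0: "0 \<le> P" using C0 by (simp add: P_def)
  have Ta: "invertible_mpt M (T a)" using T by simp
  \<comment> \<open>Each of the three errors may cost \<open>\<epsilon> / 4\<close>; the denominator
    has \<open>P + 1\<close> because \<open>P\<close> may be 0.\<close>
  define \<eta> where "\<eta> = \<epsilon> / (4 * (P + 1))"
  have \<eta>: "\<eta> > 0" "P * \<eta> \<le> \<epsilon> / 4"
  proof -
    show "\<eta> > 0" using \<epsilon> P0 by (simp add: \<eta>_def)
    have "P * \<epsilon> \<le> (P + 1) * \<epsilon>" using \<epsilon> by (intro mult_right_mono) auto
    then show "P * \<eta> \<le> \<epsilon> / 4" using P0 by (simp add: \<eta>_def field_simps)
  qed
  obtain h r C' where h: "\<And>x. norm (h x) \<le> C'" and r: "integrable M r" "(LINT x|M. norm (r x)) < \<eta>"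
    and dec: "\<And>x. f a x = e a x + (h (T a x) - h x) + r x"
    by (rule coboundary_decomposition[OF M invertible_mptD(1)[OF Ta] f(1)[of a] f(2)[of a]
          e(1)[of a] lim \<eta>(1)]) (simp_all, rule that)
  define C2 where "C2 = max C C'"
  have f_le: "norm (f i x) \<le> C2" if "i \<in> I" for i x using f(2)[of i x] that by (simp add: C2_def)
  have h_le: "norm (h x) \<le> C2" for x using h[of x] by (simp add: C2_def)
  let ?F = "\<lambda>n x. \<Prod>i\<in>I. f i (iter_int M (T i) \<lfloor>g i (real n)\<rfloor> x)"
  let ?k = "\<lambda>n. \<lfloor>g a (real n)\<rfloor>"
  let ?t = "\<lambda>k x. iter_int M (T a) k x"
  let ?err = "\<lambda>N x. norm (prod_average M I T f g N x - (\<Prod>i\<in>I. e i x))"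
  have F_le: "norm (?F n x) \<le> P" for n x
    unfolding P_def by (rule norm_prod_le_power) (use f(2) in auto)
  have "\<forall>\<^sub>F N in sequentially. C * (LINT x|M. ?err N x) < \<epsilon> / 4"
    using tendsto_mult_right_zero[OF IH, of C] \<epsilon> by (intro order_tendstoD(2)) auto
  moreover have "\<forall>\<^sub>F N in sequentially. \<forall>u v. (\<forall>m. norm (u m) \<le> C2) \<longrightarrow> (\<forall>i\<in>I. \<forall>m. norm (v i m) \<le> C2) \<longrightarrow>
    norm ((\<Sum>n=1..N. (u (?k n + 1) - u (?k n)) * (\<Prod>i\<in>I. v i \<lfloor>g i (real n)\<rfloor>)) / of_nat N :: complex) \<le> \<epsilon> / 4"
    by (rule coboundary_average_vanishes) (use g slow \<epsilon> I in auto)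
  ultimately show "\<forall>\<^sub>F N in sequentially. dist (LINT x|M. norm (prod_average M (insert a I) T f g N x
      - (\<Prod>i\<in>insert a I. e i x))) 0 < \<epsilon>"
    using eventually_gt_at_top[of 0]
  proof eventually_elim
    case (elim N)
    let ?R = "\<lambda>x. (\<Sum>n=1..N. norm (r (?t (?k n) x))) * (P / N)"
    have r_int: "integrable M (\<lambda>x. norm (r (?t k x)))" for k
      by (intro integrable_norm integrable_measure_preserving[OF iter_int_measure_preserving[OF Ta] r(1)])
    have R_int: "integrable M ?R" by (intro integrable_mult_left Bochner_Integration.integrable_sum r_int)
    have "(LINT x|M. ?R x) = (\<Sum>n=1..N. LINT x|M. norm (r (?t (?k n) x))) * (P / N)"
      using r_int by simp
    also have "(\<Sum>n=1..N. LINT x|M. norm (r (?t (?k n) x))) = N * (LINT x|M. norm (r x))"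
    proof -
      have "(LINT x|M. norm (r (?t k x))) = (LINT x|M. norm (r x))" for k
        by (rule integral_measure_preserving[OF iter_int_measure_preserving[OF Ta], of "\<lambda>x. norm (r x)"])
           (use r(1) in auto)
      then show ?thesis by simp
    qed
    also have "N * (LINT x|M. norm (r x)) * (P / N) = P * (LINT x|M. norm (r x))"
      using elim(3) by simp
    also have "\<dots> \<le> P * \<eta>" using r(2) P0 by (intro mult_left_mono) auto
    also note \<eta>(2)
    finally have R_le: "(LINT x|M. ?R x) \<le> \<epsilon> / 4" .
    have err_int: "integrable M (?err N)"
      by (rule integrable_prod_average_error[OF M]) (use T f e C0 in auto)
    have pointwise: "norm (prod_average M (insert a I) T f g N x - (\<Prod>i\<in>insert a I. e i x))
        \<le> C * ?err N x + \<epsilon> / 4 + ?R x" if x: "x \<in> space M" for x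
    proof -
      define u where "u k = h (?t k x)" for k
      have "f a (?t k x) = e a x + (u (k + 1) - u k) + r (?t k x)" for k
        using dec[of "?t k x"] iter_int_invariant[where e = "e a", OF Ta x e_inv]
        by (simp add: u_def iter_int_add_one[OF Ta x])
      then have "prod_average M (insert a I) T f g N x
          = (\<Sum>n=1..N. (e a x + (u (?k n + 1) - u (?k n)) + r (?t (?k n) x)) * ?F n x) / of_nat N"
        using I by (simp add: prod_average_def)
      also have "\<dots> = e a x * prod_average M I T f g N x
          + (\<Sum>n=1..N. (u (?k n + 1) - u (?k n)) * ?F n x) / of_nat N
          + (\<Sum>n=1..N. r (?t (?k n) x) * ?F n x) / of_nat N"
        by (simp only: prod_average_def distrib_right sum.distrib add_divide_distrib sum_distrib_left
            times_divide_eq_right)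
      finally have split: "prod_average M (insert a I) T f g N x - (\<Prod>i\<in>insert a I. e i x)
          = e a x * (prod_average M I T f g N x - (\<Prod>i\<in>I. e i x))
          + (\<Sum>n=1..N. (u (?k n + 1) - u (?k n)) * ?F n x) / of_nat N
          + (\<Sum>n=1..N. r (?t (?k n) x) * ?F n x) / of_nat N"
        using I by (simp add: algebra_simps)
      have "norm (prod_average M (insert a I) T f g N x - (\<Prod>i\<in>insert a I. e i x))
          \<le> norm (e a x * (prod_average M I T f g N x - (\<Prod>i\<in>I. e i x)))
          + norm ((\<Sum>n=1..N. (u (?k n + 1) - u (?k n)) * ?F n x) / of_nat N)
          + norm ((\<Sum>n=1..N. r (?t (?k n) x) * ?F n x) / of_nat N)"
        unfolding split by (rule order_trans[OF norm_triangle_ineq add_right_mono[OF norm_triangle_ineq]])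
      also have "\<dots> \<le> C * ?err N x + \<epsilon> / 4 + ?R x"
      proof (intro add_mono)
        show "norm (e a x * (prod_average M I T f g N x - (\<Prod>i\<in>I. e i x))) \<le> C * ?err N x"
          unfolding norm_mult using e(2)[of a x] by (intro mult_right_mono) auto
        \<comment> \<open>With \<open>x\<close> fixed, \<open>h\<close> along the orbit of
          \<open>T a\<close> and \<open>f i\<close> along the orbits of the other maps are sequences
          bounded by \<open>C2\<close>, which is all that the uniform estimate asks for.\<close>
        show "norm ((\<Sum>n=1..N. (u (?k n + 1) - u (?k n)) * ?F n x) / of_nat N) \<le> \<epsilon> / 4"
          using elim(2)[rule_format, of u "\<lambda>i m. f i (iter_int M (T i) m x)"] h_le f_le
          by (simp add: u_def)
        have "norm (\<Sum>n=1..N. r (?t (?k n) x) * ?F n x) \<le> (\<Sum>n=1..N. norm (r (?t (?k n) x)) * P)"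
          by (rule sum_norm_le) (simp add: norm_mult F_le mult_left_mono)
        then show "norm ((\<Sum>n=1..N. r (?t (?k n) x) * ?F n x) / of_nat N) \<le> ?R x"
          by (simp add: norm_divide divide_right_mono sum_distrib_right)
      qed
      finally show ?thesis .
    qed
    have "(LINT x|M. norm (prod_average M (insert a I) T f g N x - (\<Prod>i\<in>insert a I. e i x)))
        \<le> (LINT x|M. C * ?err N x + \<epsilon> / 4 + ?R x)"
    proof (rule integral_mono)
      show "integrable M (\<lambda>x. norm (prod_average M (insert a I) T f g N x - (\<Prod>i\<in>insert a I. e i x)))"
        by (rule integrable_prod_average_error[OF M]) (use T f e C0 in auto)
    qed (use err_int R_int pointwise in auto)
    also have "\<dots> = C * (LINT x|M. ?err N x) + \<epsilon> / 4 + (LINT x|M. ?R x)"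
      using err_int R_int by (simp add: prob_space)
    finally have "(LINT x|M. norm (prod_average M (insert a I) T f g N x - (\<Prod>i\<in>insert a I. e i x))) < \<epsilon>"
      using elim(1) R_le \<epsilon> by linarith
    then show ?case unfolding dist_real_def diff_zero by (subst abs_of_nonneg) simp_all
  qed
qed

lemma complex_cond_exp_measurable:
  assumes "T \<in> M \<rightarrow>\<^sub>M M"
  shows "complex_cond_exp M (invariant_algebra M T) f \<in> borel_measurable M"
    and "x \<in> space M \<Longrightarrow> complex_cond_exp M (invariant_algebra M T) f (T x)
      = complex_cond_exp M (invariant_algebra M T) f x"
proof -
  show "complex_cond_exp M (invariant_algebra M T) f \<in> borel_measurable M"
    unfolding borel_measurable_complex_iff complex_cond_exp_def by simp
  show "complex_cond_exp M (invariant_algebra M T) f (T x)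
      = complex_cond_exp M (invariant_algebra M T) f x" if "x \<in> space M"
    by (simp add: complex_cond_exp_def measurable_invariant_algebra_invariant[OF assms _ that])
qed

lemma slower_trans:
  assumes "slower h2 h1" "slower h3 h2"
  shows "slower h3 h1"
  unfolding slower_def
proof (rule filterlim_at_top_mono)
  let ?p = "\<lambda>x. (\<bar>h1 x\<bar> / \<bar>h2 x\<bar>) * (\<bar>h2 x\<bar> / \<bar>h3 x\<bar>)"
  show "filterlim ?p at_top at_top"
    using assms unfolding slower_def by (rule filterlim_at_top_mult_at_top)
  \<comment> \<open>An inequality and not an equation, since the product is 0 wherever
    \<open>h2\<close> vanishes.\<close>
  show "\<forall>\<^sub>F x in at_top. ?p x \<le> \<bar>h1 x\<bar> / \<bar>h3 x\<bar>"
    by (rule always_eventually) auto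
qed

lemma slower_chain:
  fixes g :: "nat \<Rightarrow> real \<Rightarrow> real"
  assumes "\<And>i. i \<in> {1..<l} \<Longrightarrow> slower (g (i + 1)) (g i)" "1 \<le> a" "a < j" "j \<le> l"
  shows "slower (g j) (g a)"
proof -
  from \<open>a < j\<close> have "Suc a \<le> j" by simp
  then show ?thesis using \<open>j \<le> l\<close>
  proof (induction rule: dec_induct)
    case base
    then show ?case using assms(1)[of a] assms(2) by simp
  next
    case (step j)
    then have "slower (g (j + 1)) (g j)" using assms(1)[of j] assms(2) by simp
    moreover have "slower (g j) (g a)" using step by simp
    ultimately show ?case using slower_trans by simp
  qed
qed

text \<open>Indices are added from the slowest function to the fastest, so that each new one
  dominates all those already present.\<close>

lemma prod_average_L1_convergence:
  fixes f e :: "nat \<Rightarrow> 'a \<Rightarrow> complex"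
  assumes M: "prob_space M"
    and T: "\<And>i. i \<in> {1..l} \<Longrightarrow> invertible_mpt M (T i)"
    and f: "\<And>i. i \<in> {1..l} \<Longrightarrow> f i \<in> borel_measurable M"
      "\<And>i x. i \<in> {1..l} \<Longrightarrow> norm (f i x) \<le> C"
    and e: "\<And>i. i \<in> {1..l} \<Longrightarrow> e i \<in> borel_measurable M"
      "\<And>i x. i \<in> {1..l} \<Longrightarrow> norm (e i x) \<le> C"
    and e_inv: "\<And>i x. i \<in> {1..l} \<Longrightarrow> x \<in> space M \<Longrightarrow> e i (T i x) = e i x"
    and lim: "\<And>i. i \<in> {1..l} \<Longrightarrow>
      AE x in M. (\<lambda>n. (\<Sum>j<n. f i ((T i ^^ j) x)) / of_nat n) \<longlonglongrightarrow> e i x"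
    and g: "\<And>i. i \<in> {1..l} \<Longrightarrow> g i \<in> class_F"
    and slow: "\<And>i. i \<in> {1..<l} \<Longrightarrow> slower (g (i + 1)) (g i)"
  shows "(\<lambda>N. LINT x|M. norm (prod_average M {1..l} T f g N x - (\<Prod>i=1..l. e i x))) \<longlonglongrightarrow> 0"
proof -
  have "1 \<le> Suc l" by simp
  then show ?thesis
  proof (induction rule: inc_induct)
    case base
    \<comment> \<open>At \<open>N = 0\<close> the average is 0 while the empty product is 1, so the
      equation holds only eventually.\<close>
    have "\<forall>\<^sub>F N in sequentially. (LINT x|M. norm (prod_average M {Suc l..l} T f g N x - (\<Prod>i=Suc l..l. e i x))) = 0"
      using eventually_gt_at_top[of 0] by eventually_elim (simp add: prod_average_def)
    then show ?case by (rule tendsto_eventually)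
  next
    case (step a)
    have ins: "{a..l} = insert a {Suc a..l}" using step.hyps by auto
    have sub: "{a..l} \<subseteq> {1..l}" "a \<in> {1..l}" using step.hyps by auto
    show ?case
      unfolding ins
    proof (rule prod_average_insert[where C = C])
      show "slower (g i) (g a)" if "i \<in> {Suc a..l}" for i
        using that step.hyps by (intro slower_chain[where g = g and l = l, OF slow]) auto
    qed (use M T f e e_inv lim g step.IH sub ins in \<open>auto simp del: insert_iff\<close>)
  qed
qed

text \<open>Supplies a version of an essentially bounded function that is bounded at every point. It
  acts on values only, so it keeps invariant functions invariant.\<close>

definition truncate_above :: "real \<Rightarrow> ('a \<Rightarrow> complex) \<Rightarrow> 'a \<Rightarrow> complex" where
  "truncate_above C f x = (if norm (f x) \<le> C then f x else 0)"

lemma truncate_above_norm_le: "0 \<le> C \<Longrightarrow> norm (truncate_above C f x) \<le> C"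
  by (simp add: truncate_above_def)

lemma truncate_above_measurable [measurable]:
  assumes [measurable]: "f \<in> borel_measurable M"
  shows "truncate_above C f \<in> borel_measurable M"
  unfolding truncate_above_def[abs_def] by measurable

lemma truncate_above_AE_eq:
  "AE x in M. norm (f x) \<le> C \<Longrightarrow> AE x in M. truncate_above C f x = f x"
  by (auto simp: truncate_above_def elim: AE_mp)

text \<open>The modulus of \<open>E\<close> is bounded as a limit of ergodic averages: treating real
  and imaginary parts separately would lose a constant, whereas one \<open>C\<close> is to serve for
  both \<open>f\<close> and \<open>E\<close>.\<close>

lemma birkhoff_truncated:
  fixes f :: "'a \<Rightarrow> complex"
  assumes M: "prob_space M" and T: "measure_preserving_map M T" and f: "f \<in> borel_measurable M"
    and C: "AE x in M. norm (f x) \<le> C" "0 \<le> C"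
  defines "E \<equiv> complex_cond_exp M (invariant_algebra M T) f"
  shows "AE x in M. norm (E x) \<le> C"
    and "AE x in M. (\<lambda>n. (\<Sum>i<n. truncate_above C f ((T ^^ i) x)) / of_nat n) \<longlonglongrightarrow> truncate_above C E x"
proof -
  interpret prob_space M by fact
  have int: "integrable M f" using C(1) f by (intro integrable_const_bound[where B = C])
  let ?A = "\<lambda>n x. (\<Sum>i<n. truncate_above C f ((T ^^ i) x)) / of_nat n"
  have "AE x in M. \<forall>i. truncate_above C f ((T ^^ i) x) = f ((T ^^ i) x)"
    unfolding AE_all_countable
    by (intro allI AE_measure_preserving[OF measure_preserving_map_funpow[OF T]] truncate_above_AE_eq C)
  then have lim: "AE x in M. (\<lambda>n. ?A n x) \<longlonglongrightarrow> E x"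
    using complex_birkhoff_ergodic[OF M T int] by eventually_elim (simp add: E_def)
  have A_le: "norm (?A n x) \<le> C" for n x
  proof -
    have "norm (\<Sum>i<n. truncate_above C f ((T ^^ i) x)) \<le> real (card {..<n}) * C"
      by (rule sum_norm_bound) (rule truncate_above_norm_le[OF C(2)])
    then show ?thesis using C by (cases "n = 0") (simp_all add: norm_divide field_simps)
  qed
  show E: "AE x in M. norm (E x) \<le> C"
    using lim by eventually_elim (rule Lim_norm_ubound[OF _ _ always_eventually], auto simp: A_le)
  show "AE x in M. (\<lambda>n. ?A n x) \<longlonglongrightarrow> truncate_above C E x"
    using lim truncate_above_AE_eq[OF E] by eventually_elim simp
qed

lemma multiple_average_eq: "multiple_average M l T f g N x = prod_average M {1..l} T f g N x"
  by (simp add: multiple_average_def prod_average_def)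

theorem theorem2p4:
  fixes l :: nat
    and M :: "'a measure"
    and T :: "nat \<Rightarrow> 'a \<Rightarrow> 'a"
    and f :: "nat \<Rightarrow> 'a \<Rightarrow> complex"
    and g :: "nat \<Rightarrow> real \<Rightarrow> real"
  assumes "1 \<le> l"
    and "prob_space M"
    and "\<And>i. i \<in> {1..l} \<Longrightarrow> invertible_mpt M (T i)"
    and "\<And>i. i \<in> {1..l} \<Longrightarrow> f i \<in> L_infinity M"
    and "\<And>i. i \<in> {1..l} \<Longrightarrow> g i \<in> class_F"
    and "\<And>i. i \<in> {1..<l} \<Longrightarrow> slower (g (i + 1)) (g i)"
    and "\<And>i. i \<in> {1..<l} \<Longrightarrow>
           eventually_monotone (\<lambda>x. deriv (g (i + 1)) x / deriv (g i) x)"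
  shows "(\<lambda>N. L2_dist M (multiple_average M l T f g N)
            (\<lambda>x. \<Prod>i=1..l. complex_cond_exp M (invariant_algebra M (T i)) (f i) x))
         \<longlonglongrightarrow> 0"
proof -
  interpret prob_space M by fact
  note T = assms(3)
  note mp = invertible_mptD(1)[OF T]
  have f: "f i \<in> borel_measurable M" if "i \<in> {1..l}" for i
    using assms(4)[OF that] by (simp add: L_infinity_def)
  have "\<exists>c. AE x in M. norm (f i x) \<le> c" if "i \<in> {1..l}" for i
    using assms(4)[OF that] by (simp add: L_infinity_def)
  then obtain c where c: "AE x in M. norm (f i x) \<le> c i" if "i \<in> {1..l}" for i by metis
  define C where "C = (\<Sum>i=1..l. \<bar>c i\<bar>)"
  have C0: "0 \<le> C" by (simp add: C_def sum_nonneg)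
  have fC: "AE x in M. norm (f i x) \<le> C" if "i \<in> {1..l}" for i
  proof -
    have "\<bar>c i\<bar> \<le> C" unfolding C_def using that by (intro member_le_sum) auto
    then have "c i \<le> C" by linarith
    then show ?thesis using c[OF that] by (auto elim: AE_mp)
  qed
  define E where "E i = complex_cond_exp M (invariant_algebra M (T i)) (f i)" for i
  define f' where "f' i = truncate_above C (f i)" for i
  define e where "e i = truncate_above C (E i)" for i
  have E: "E i \<in> borel_measurable M" if "i \<in> {1..l}" for i
    unfolding E_def by (rule complex_cond_exp_measurable measure_preserving_mapD mp that)+
  have f': "f' i \<in> borel_measurable M" and e: "e i \<in> borel_measurable M" if "i \<in> {1..l}" for i
    unfolding f'_def e_def using f[OF that] E[OF that] by simp_all
  have f'_le: "norm (f' i x) \<le> C" and e_le: "norm (e i x) \<le> C" for i x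
    unfolding f'_def e_def by (rule truncate_above_norm_le[OF C0])+
  have EC: "AE x in M. norm (E i x) \<le> C" if "i \<in> {1..l}" for i
    unfolding E_def by (rule birkhoff_truncated(1)[OF assms(2) mp f fC C0]) (rule that)+
  let ?err = "\<lambda>N x. norm (prod_average M {1..l} T f' g N x - (\<Prod>i=1..l. e i x))"
  have L1: "(\<lambda>N. LINT x|M. ?err N x) \<longlonglongrightarrow> 0"
  proof (rule prod_average_L1_convergence[where C = C])
    show "e i (T i x) = e i x" if "i \<in> {1..l}" "x \<in> space M" for i x
      using complex_cond_exp_measurable(2)[OF measure_preserving_mapD(1)[OF mp[OF that(1)]] that(2)]
      by (simp add: e_def E_def truncate_above_def)
    show "AE x in M. (\<lambda>n. (\<Sum>j<n. f' i ((T i ^^ j) x)) / of_nat n) \<longlonglongrightarrow> e i x"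
      if "i \<in> {1..l}" for i
      unfolding f'_def e_def E_def by (rule birkhoff_truncated[OF assms(2) mp f fC C0]) (rule that)+
  qed (use assms f' e f'_le e_le in auto)
  have err: "?err N x \<le> 2 * C ^ l" "integrable M (?err N)" for N x
    using integrable_prod_average_error[where I = "{1..l}", OF assms(2) T f' f'_le e e_le C0] by simp_all
  \<comment> \<open>There are countably many exponents \<open>k\<close>, so one null set serves all
    of them, and hence all N at once.\<close>
  have "AE x in M. \<forall>i\<in>{1..l}. \<forall>k. f' i (iter_int M (T i) k x) = f i (iter_int M (T i) k x)"
    unfolding f'_def
    by (intro AE_finite_allI AE_all_countable[THEN iffD2] allI finite_atLeastAtMost
        AE_measure_preserving[OF iter_int_measure_preserving] truncate_above_AE_eq fC T)
  moreover have "AE x in M. \<forall>i\<in>{1..l}. e i x = E i x"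
    unfolding e_def by (intro AE_finite_allI finite_atLeastAtMost truncate_above_AE_eq EC)
  ultimately have eq: "AE x in M. \<forall>N. multiple_average M l T f g N x - (\<Prod>i=1..l. E i x)
      = prod_average M {1..l} T f' g N x - (\<Prod>i=1..l. e i x)"
    by eventually_elim (simp add: multiple_average_eq prod_average_def)
  have L2_le: "(LINT x|M. (norm (multiple_average M l T f g N x - (\<Prod>i=1..l. E i x)))\<^sup>2)
      \<le> 2 * C ^ l * (LINT x|M. ?err N x)" for N
  proof -
    have sq: "(?err N x)\<^sup>2 \<le> 2 * C ^ l * ?err N x" for x
      unfolding power2_eq_square by (rule mult_right_mono[OF err(1)]) simp
    have "(LINT x|M. (norm (multiple_average M l T f g N x - (\<Prod>i=1..l. E i x)))\<^sup>2)
        \<le> (LINT x|M. 2 * C ^ l * ?err N x)"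
    proof (rule integral_mono_AE')
      show "AE x in M. (norm (multiple_average M l T f g N x - (\<Prod>i=1..l. E i x)))\<^sup>2
          \<le> 2 * C ^ l * ?err N x"
        using eq by eventually_elim (simp only: sq)
      show "AE x in M. 0 \<le> 2 * C ^ l * ?err N x" using C0 by simp
    qed (use err(2) in simp)
    then show ?thesis by simp
  qed
  have "(\<lambda>N. LINT x|M. (norm (multiple_average M l T f g N x - (\<Prod>i=1..l. E i x)))\<^sup>2) \<longlonglongrightarrow> 0"
  proof (rule tendsto_sandwich[OF _ _ tendsto_const])
    show "(\<lambda>N. 2 * C ^ l * (LINT x|M. ?err N x)) \<longlonglongrightarrow> 0"
      by (rule tendsto_mult_right_zero[OF L1])
  qed (use L2_le in \<open>auto intro!: always_eventually\<close>)
  from tendsto_real_sqrt[OF this] show ?thesis by (simp add: L2_dist_def E_def)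
qed

end
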